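(* Let $\omega\ge 3$ be an integer, and assume $\Delta\ge\omega$. In both the deterministic and the randomized LOCAL model, $\Delta$-coloring $K_{\omega+1}$-free graphs ($n$ nodes, maximum degree $\Delta$) reduces to solving $(\Delta+1)$-coloring, applying $\omega$ rounds of color reduction, and solving $\omega$-coloring on a graph of maximum degree $\omega$. That is, letting $T_{\Delta\text{-col}}^{\omega}(n,\Delta)$ and $T_{\Delta\text{-col}}^{\omega,\mathrm{rand}}(n,\Delta)$ denote the deterministic and randomized complexities of $\Delta$-coloring on $n$-node $K_{\omega+1}$-free graphs of maximum degree $\Delta$, $$T_{\Delta\text{-col}}^{\omega}(n,\Delta)\in O\big(T_{(\Delta+1)\text{-col}}(n,\Delta)+\omega+T_{\Delta\text{-col}}(n,\omega)\big),$$ $$T_{\Delta\text{-col}}^{\omega,\mathrm{rand}}(n,\Delta)\in O\big(T_{(\Delta+1)\text{-col}}^{\mathrm{rand}}(n,\Delta)+\omega+T_{\Delta\text{-col}}^{\mathrm{rand}}(n,\omega)\big).$$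
   Context: LOCAL model: the nodes of the input graph are computational entities communicating along edges in synchronous rounds; in each round every node sends arbitrarily large messages to its neighbors, receives messages, and performs arbitrary internal computation. Each node initially knows its degree, a port numbering of its incident edges, and the global parameters such as $n$ (number of nodes) and $\Delta$ (maximum degree). In the deterministic LOCAL model nodes have unique identifiers from $\{1,\dots,\mathrm{poly}(n)\}$; in the randomized LOCAL model each node instead has a private random bit string and algorithms must be correct with probability at least $1-1/n$. The complexity of an algorithm is the worst-case number of rounds until termination; the complexity of a problem is that of an optimal algorithm. $\Delta$-coloring (resp. $(\Delta+1)$-coloring): color the nodes of a graph of maximum degree $\Delta$ properly with colors $\{1,\dots,\Delta\}$ (resp. $\{1,\dots,\Delta+1\}$). For $\Delta$-coloring, input graphs are assumed to be $\Delta$-colorable, with $\Delta\ge 3$; i.e. (by Brooks' theorem) no connected component is a $(\Delta+1)$-clique. $T_{\Delta\text{-col}}(n,D)$ and $T_{(\Delta+1)\text{-col}}(n,D)$ denote the deterministic LOCAL complexities of coloring $n$-node graphs of maximum degree $D$ with $D$, respectively $D+1$, colors; the superscript $\mathrm{rand}$ denotes the corresponding randomized complexities. A graph is $K_{\omega+1}$-free if it contains no clique on $\omega+1$ nodes. Color reduction here: iterating over a set of color classes one per round, each node of the current class switches to a color from a fixed replacement set not used in its neighborhood, if one exists. *)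

theory Defs
  imports
    "HOL-Probability.Product_PMF"
    "HOL-Library.Extended_Nat"
    "HOL-Library.Landau_Symbols"
begin

section \<open>Port-numbered graphs and colorings\<close>

text \<open>
  A simple graph on the nodes \<open>0, \<dots>, n - 1\<close> together with a port numbering: \<open>G v\<close> lists the
  neighbors of \<open>v\<close> in the order of the ports of \<open>v\<close>, so port \<open>p\<close> of \<open>v\<close> leads to \<open>G v ! p\<close>.
  Node names are invisible to algorithms. Graphs need not be connected.
\<close>

type_synonym port_graph = "nat \<Rightarrow> nat list"

definition is_graph :: "nat \<Rightarrow> port_graph \<Rightarrow> bool" where
  "is_graph n G \<longleftrightarrow>
     (\<forall>v<n. distinct (G v) \<and> set (G v) \<subseteq> {..<n} - {v}) \<and>
     (\<forall>u<n. \<forall>v<n. u \<in> set (G v) \<longleftrightarrow> v \<in> set (G u))"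

definition degree :: "port_graph \<Rightarrow> nat \<Rightarrow> nat" where
  "degree G v = length (G v)"

definition max_degree :: "nat \<Rightarrow> port_graph \<Rightarrow> nat" where
  "max_degree n G = Max (degree G ` {..<n})"

definition clique_free :: "nat \<Rightarrow> nat \<Rightarrow> port_graph \<Rightarrow> bool" where
  "clique_free k n G \<longleftrightarrow>
     \<not> (\<exists>K \<subseteq> {..<n}. card K = k \<and> (\<forall>u\<in>K. \<forall>v\<in>K. u \<noteq> v \<longrightarrow> u \<in> set (G v)))"

definition proper_coloring :: "nat \<Rightarrow> nat \<Rightarrow> port_graph \<Rightarrow> (nat \<Rightarrow> nat) \<Rightarrow> bool" where
  "proper_coloring k n G c \<longleftrightarrow>
     (\<forall>v<n. c v \<in> {1..k}) \<and> (\<forall>v<n. \<forall>u \<in> set (G v). c u \<noteq> c v)"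

definition colorable :: "nat \<Rightarrow> nat \<Rightarrow> port_graph \<Rightarrow> bool" where
  "colorable k n G \<longleftrightarrow> (\<exists>c. proper_coloring k n G c)"

text \<open>
  As usual in the LOCAL model, the parameter called maximum degree is a known upper bound on
  the degrees.
\<close>

definition graphs :: "nat \<Rightarrow> nat \<Rightarrow> port_graph set" where
  "graphs n D = {G. is_graph n G \<and> max_degree n G \<le> D}"


section \<open>LOCAL algorithms\<close>

text \<open>
  States and messages are natural numbers. This is no restriction on message size or internal
  computation: all data a node can ever hold (degrees, identifiers, finite bit strings, and finite
  lists thereof) are countable and hence can be encoded.

  \<open>init\<close> receives the global parameters (number of nodes, maximum degree), the degree of the node
  and its private input of type \<open>'i\<close> (an identifier or a random bit string). \<open>send\<close> gives the
  message for each port, and \<open>receive\<close> gets the incoming messages in port order. A node terminates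
  as soon as \<open>result\<close> yields a value for its state. From then on its state is frozen and it sends
  nothing, which its neighbors observe as \<open>None\<close>.
\<close>

record 'i local_alg =
  init :: "nat \<Rightarrow> nat \<Rightarrow> nat \<Rightarrow> 'i \<Rightarrow> nat"
  send :: "nat \<Rightarrow> nat \<Rightarrow> nat"
  receive :: "nat \<Rightarrow> nat option list \<Rightarrow> nat"
  result :: "nat \<Rightarrow> nat option"

definition port_to :: "port_graph \<Rightarrow> nat \<Rightarrow> nat \<Rightarrow> nat" where
  "port_to G u v = (THE p. p < length (G u) \<and> G u ! p = v)"

definition outgoing :: "'i local_alg \<Rightarrow> nat \<Rightarrow> nat \<Rightarrow> nat option" where
  "outgoing A s p = (if result A s = None then Some (send A s p) else None)"

primrec state ::
  "'i local_alg \<Rightarrow> nat \<Rightarrow> nat \<Rightarrow> port_graph \<Rightarrow> (nat \<Rightarrow> 'i) \<Rightarrow> nat \<Rightarrow> nat \<Rightarrow> nat" where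
  "state A n D G x 0 = (\<lambda>v. init A n D (degree G v) (x v))"
| "state A n D G x (Suc t) = (\<lambda>v.
     if result A (state A n D G x t v) = None
     then receive A (state A n D G x t v)
            (map (\<lambda>u. outgoing A (state A n D G x t u) (port_to G u v)) (G v))
     else state A n D G x t v)"

definition terminated ::
  "'i local_alg \<Rightarrow> nat \<Rightarrow> nat \<Rightarrow> port_graph \<Rightarrow> (nat \<Rightarrow> 'i) \<Rightarrow> nat \<Rightarrow> bool" where
  "terminated A n D G x t \<longleftrightarrow> (\<forall>v<n. result A (state A n D G x t v) \<noteq> None)"

text \<open>The running time is \<open>\<infinity>\<close> if some node never terminates.\<close>

definition running_time ::
  "'i local_alg \<Rightarrow> nat \<Rightarrow> nat \<Rightarrow> port_graph \<Rightarrow> (nat \<Rightarrow> 'i) \<Rightarrow> enat" where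
  "running_time A n D G x = (INF t \<in> {t. terminated A n D G x t}. enat t)"

definition colors_properly ::
  "nat \<Rightarrow> 'i local_alg \<Rightarrow> nat \<Rightarrow> nat \<Rightarrow> port_graph \<Rightarrow> (nat \<Rightarrow> 'i) \<Rightarrow> bool" where
  "colors_properly k A n D G x \<longleftrightarrow>
     (\<exists>t. terminated A n D G x t \<and>
          proper_coloring k n G (\<lambda>v. the (result A (state A n D G x t v))))"


section \<open>Deterministic and randomized complexity\<close>

text \<open>
  In what follows, \<open>\<G>\<close> is the set of admissible \<open>n\<close>-node inputs and \<open>k\<close> the number of colors.
  Complexities are infima in \<^typ>\<open>enat\<close>, so they would be \<open>\<infinity>\<close> if no algorithm existed.
\<close>

definition id_assignments :: "nat \<Rightarrow> nat \<Rightarrow> (nat \<Rightarrow> nat) set" where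
  "id_assignments N n = {x. inj_on x {..<n} \<and> x ` {..<n} \<subseteq> {1..N}}"

definition det_correct ::
  "nat \<Rightarrow> nat \<Rightarrow> nat \<Rightarrow> nat \<Rightarrow> port_graph set \<Rightarrow> nat local_alg \<Rightarrow> bool" where
  "det_correct N k n D \<G> A \<longleftrightarrow>
     (\<forall>G\<in>\<G>. \<forall>x \<in> id_assignments N n. colors_properly k A n D G x)"

definition det_time :: "nat \<Rightarrow> nat \<Rightarrow> nat \<Rightarrow> port_graph set \<Rightarrow> nat local_alg \<Rightarrow> enat" where
  "det_time N n D \<G> A = (SUP G\<in>\<G>. SUP x \<in> id_assignments N n. running_time A n D G x)"

definition det_complexity :: "nat \<Rightarrow> nat \<Rightarrow> nat \<Rightarrow> nat \<Rightarrow> port_graph set \<Rightarrow> enat" where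
  "det_complexity N k n D \<G> = (INF A \<in> {A. det_correct N k n D \<G> A}. det_time N n D \<G> A)"

text \<open>
  A randomized algorithm also fixes the length \<open>b\<close> of the uniformly random bit strings. Since
  complexities are taken separately for all \<open>n\<close> and \<open>D\<close>, this length may depend arbitrarily on
  both. The running time is the worst case over all random bits as well.
\<close>

definition bit_strings :: "nat \<Rightarrow> bool list set" where
  "bit_strings b = {r. length r = b}"

definition random_bits :: "nat \<Rightarrow> nat \<Rightarrow> (nat \<Rightarrow> bool list) pmf" where
  "random_bits b n = Pi_pmf {..<n} [] (\<lambda>_. pmf_of_set (bit_strings b))"

definition rand_correct ::
  "nat \<Rightarrow> nat \<Rightarrow> nat \<Rightarrow> port_graph set \<Rightarrow> nat \<Rightarrow> bool list local_alg \<Rightarrow> bool" where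
  "rand_correct k n D \<G> b A \<longleftrightarrow>
     (\<forall>G\<in>\<G>. measure_pmf.prob (random_bits b n) {x. colors_properly k A n D G x}
               \<ge> 1 - 1 / real n)"

definition rand_time ::
  "nat \<Rightarrow> nat \<Rightarrow> port_graph set \<Rightarrow> nat \<Rightarrow> bool list local_alg \<Rightarrow> enat" where
  "rand_time n D \<G> b A =
     (SUP G\<in>\<G>. SUP x \<in> {x. \<forall>v<n. x v \<in> bit_strings b}. running_time A n D G x)"

definition rand_complexity :: "nat \<Rightarrow> nat \<Rightarrow> nat \<Rightarrow> port_graph set \<Rightarrow> enat" where
  "rand_complexity k n D \<G> =
     (INF (b, A) \<in> {(b, A). rand_correct k n D \<G> b A}. rand_time n D \<G> b A)"


section \<open>The coloring problems\<close>

text \<open>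
  Identifiers of \<open>n\<close>-node graphs come from \<open>{1..idb n}\<close>. In the last two definitions,
  \<open>D\<close>-colorability of the inputs need not be assumed: for \<open>3 \<le> \<omega> \<le> D\<close> it follows from
  Brooks' theorem.
\<close>

definition T_Delta_plus_one_col :: "(nat \<Rightarrow> nat) \<Rightarrow> nat \<Rightarrow> nat \<Rightarrow> enat" where
  "T_Delta_plus_one_col idb n D = det_complexity (idb n) (D + 1) n D (graphs n D)"

definition T_Delta_col :: "(nat \<Rightarrow> nat) \<Rightarrow> nat \<Rightarrow> nat \<Rightarrow> enat" where
  "T_Delta_col idb n D = det_complexity (idb n) D n D {G \<in> graphs n D. colorable D n G}"

definition T_rand_Delta_plus_one_col :: "nat \<Rightarrow> nat \<Rightarrow> enat" where
  "T_rand_Delta_plus_one_col n D = rand_complexity (D + 1) n D (graphs n D)"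

definition T_rand_Delta_col :: "nat \<Rightarrow> nat \<Rightarrow> enat" where
  "T_rand_Delta_col n D = rand_complexity D n D {G \<in> graphs n D. colorable D n G}"

definition T_Delta_col_clique_free :: "(nat \<Rightarrow> nat) \<Rightarrow> nat \<Rightarrow> nat \<Rightarrow> nat \<Rightarrow> enat" where
  "T_Delta_col_clique_free idb \<omega> n D =
     det_complexity (idb n) D n D {G \<in> graphs n D. clique_free (\<omega> + 1) n G}"

definition T_rand_Delta_col_clique_free :: "nat \<Rightarrow> nat \<Rightarrow> nat \<Rightarrow> enat" where
  "T_rand_Delta_col_clique_free \<omega> n D =
     rand_complexity D n D {G \<in> graphs n D. clique_free (\<omega> + 1) n G}"

end

theory Submission
  imports Defs
begin

text \<open>
  Starting from a \<open>(\<Delta> + 1)\<close>-coloring, let the color classes \<open>\<Delta> + 1, \<Delta>, \<dots>, \<Delta> + 1 - \<omega>\<close> move one after the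
  other to the colors \<open>{1..\<Delta> - \<omega>}\<close>. A node that finds no such color has a neighbor of each of these
  colors, so the remaining nodes induce a graph of maximum degree at most \<open>\<omega>\<close>. It contains no
  \<open>(\<omega> + 1)\<close>-clique, is hence \<open>\<omega>\<close>-colorable by Brooks' theorem, and gets the last \<open>\<omega>\<close> colors.

  In the randomized model this only succeeds with probability \<open>(1 - 1/n)\<^sup>2\<close>, so the failure probability
  has to be halved without changing \<open>n\<close>. All nodes within a distance \<open>\<rho>\<close>, linear in the running time, of a failure
  replace their random bits by fresh ones, and the algorithm is run again. The second run fails with
  the same probability \<open>q\<close> as the first, independently of where the first one failed, except that one has
  to sum over all possible isolated failure sets. Their expected number is at most
  \<open>\<Prod>(1 + p\<^sub>z) - 1\<close>, where \<open>p\<^sub>z \<le> q\<close> are the failure probabilities of cells around a net of the graph, and this is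
  at most \<open>1/2\<close> because there are few cells. For small \<open>n\<close>, resampling is iterated.
\<close>

section \<open>Brooks' theorem\<close>

definition proper_on :: "('a \<Rightarrow> 'a \<Rightarrow> bool) \<Rightarrow> nat \<Rightarrow> 'a set \<Rightarrow> ('a \<Rightarrow> nat) \<Rightarrow> bool" where
  "proper_on E k S c \<longleftrightarrow> (\<forall>v\<in>S. c v \<in> {1..k}) \<and> (\<forall>u\<in>S. \<forall>v\<in>S. E u v \<longrightarrow> c u \<noteq> c v)"

locale bounded_degree_graph =
  fixes E :: "'a \<Rightarrow> 'a \<Rightarrow> bool" and V :: "'a set" and k :: nat
  assumes finV: "finite V"
    and symE: "E u v \<Longrightarrow> E v u"
    and irreflE: "\<not> E u u"
    and degE: "v \<in> V \<Longrightarrow> card {u \<in> V. E v u} \<le> k"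
begin

text \<open>The bound counts colors around \<open>v\<close>, not neighbors, so one repeated color
  compensates for a full neighborhood of \<open>k\<close> vertices.\<close>

lemma extend_vertex:
  assumes S: "S \<subseteq> V" and c: "proper_on E k S c" and card: "card (c ` {u \<in> S. E v u}) < k"
  obtains a where "proper_on E k (insert v S) (c(v := a))"
proof -
  have "finite (c ` {u \<in> S. E v u})" using finite_subset[OF S finV] by simp
  with card have "\<not> {1..k} \<subseteq> c ` {u \<in> S. E v u}"
    using card_mono[of "c ` {u \<in> S. E v u}" "{1..k}"] by auto
  then obtain a where a: "a \<in> {1..k}" "a \<notin> c ` {u \<in> S. E v u}" by blast
  have "proper_on E k (insert v S) (c(v := a))"
    using c a symE irreflE unfolding proper_on_def by (auto simp: image_iff) 
  then show ?thesis by (rule that)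
qed

text \<open>Each vertex is colored while its successor on the path is still uncolored, so at most
  \<open>k - 1\<close> neighbors restrict its color. The end \<open>w\<close> remains
  uncolored.\<close>

lemma extend_path:
  assumes "successively E (xs @ [w])" "distinct (xs @ [w])" "set (xs @ [w]) \<subseteq> V - S" "S \<subseteq> V"
    and "proper_on E k S c"
  shows "\<exists>c'. proper_on E k (S \<union> set xs) c' \<and> (\<forall>u\<in>S. c' u = c u)"
  using assms
proof (induction xs arbitrary: S c)
  case Nil
  then show ?case by auto
next
  case (Cons x xs)
  define y where "y = hd (xs @ [w])"
  have y: "E x y" "y \<in> V" "y \<notin> S" "x \<in> V" "x \<notin> S"
    using Cons.prems by (cases xs; auto simp: y_def)+
  have fin: "finite {u \<in> S. E x u}" "finite {u \<in> V. E x u}"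
    using finite_subset[OF Cons.prems(4) finV] finV by auto
  have "card (c ` {u \<in> S. E x u}) \<le> card {u \<in> S. E x u}"
    using fin by (intro card_image_le)
  also have "\<dots> < card {u \<in> V. E x u}"
    using fin y Cons.prems(4) by (intro psubset_card_mono) auto
  also have "\<dots> \<le> k" using y degE by blast
  finally obtain a where a: "proper_on E k (insert x S) (c(x := a))"
    using extend_vertex Cons.prems by metis
  have "\<exists>c'. proper_on E k (insert x S \<union> set xs) c' \<and> (\<forall>u\<in>insert x S. c' u = (c(x := a)) u)"
    using Cons.prems y by (intro Cons.IH a) (auto simp: successively_Cons)
  then show ?case using y by (auto simp: fun_upd_def split: if_splits)
qed

text \<open>Unlike the vertices before it, \<open>w\<close> may have all its neighbors colored; the
  equal colors of \<open>p\<close> and \<open>r\<close> make up for this.\<close>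

lemma extend_path_closed:
  assumes path: "successively E (xs @ [w])" "distinct (xs @ [w])" "set (xs @ [w]) \<subseteq> V - S" "S \<subseteq> V"
    and c: "proper_on E k S c"
    and pr: "p \<in> S" "r \<in> S" "p \<noteq> r" "E w p" "E w r" "c p = c r"
  shows "\<exists>c'. proper_on E k (S \<union> set (xs @ [w])) c'"
proof -
  obtain c' where c': "proper_on E k (S \<union> set xs) c'" "\<forall>u\<in>S. c' u = c u"
    using extend_path[OF path c] by blast
  let ?N = "{u \<in> S \<union> set xs. E w u}"
  have fin: "finite ?N" using finite_subset[OF path(4) finV] by auto
  have "c' ` ?N = c' ` (?N - {p})"
  proof -
    have "c' p \<in> c' ` (?N - {p})" using pr c'(2) by (auto intro!: image_eqI[of _ _ r])
    then show ?thesis by blast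
  qed
  moreover have "card (c' ` (?N - {p})) \<le> card (?N - {p})" using fin by (intro card_image_le) blast
  ultimately have "card (c' ` ?N) \<le> card (?N - {p})" by (rule ord_eq_le_trans[OF arg_cong])
  also have "\<dots> < card ?N"
  proof (rule psubset_card_mono[OF fin])
    show "?N - {p} \<subset> ?N" using pr(1,4) by auto
  qed
  also have "\<dots> \<le> card {u \<in> V. E w u}"
    using path(3,4) finV by (intro card_mono) auto
  also have "\<dots> \<le> k" using path(3) degE by auto
  finally have less: "card (c' ` ?N) < k" .
  have "S \<union> set xs \<subseteq> V" using path(3,4) by auto
  then obtain a where "proper_on E k (insert w (S \<union> set xs)) (c'(w := a))"
    using extend_vertex[OF _ c'(1) less] by blast
  then show ?thesis by (auto simp: Un_commute)
qed

end

text \<open>An extension of greatest length works, since a neighbor of its end off the path would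
  prolong it; lengths are bounded by \<open>card V\<close>.\<close>

lemma maximal_path:
  assumes "finite V" "successively E ws" "distinct ws" "set ws \<subseteq> V" "ws \<noteq> []"
  obtains ps where "successively E (ws @ ps)" "distinct (ws @ ps)" "set (ws @ ps) \<subseteq> V"
    "\<And>u. u \<in> V \<Longrightarrow> E (last (ws @ ps)) u \<Longrightarrow> u \<in> set (ws @ ps)"
proof -
  let ?P = "\<lambda>ps. successively E (ws @ ps) \<and> distinct (ws @ ps) \<and> set (ws @ ps) \<subseteq> V"
  have bound: "length ps \<le> card V" if "?P ps" for ps
  proof -
    have "length ps = card (set ps)" using that by (simp add: distinct_card)
    also have "\<dots> \<le> card V" using that assms(1) by (intro card_mono) auto
    finally show ?thesis .
  qed
  have "?P []" using assms by simp
  then obtain ps where ps: "?P ps" "\<forall>qs. ?P qs \<longrightarrow> length qs \<le> length ps"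
    using ex_has_greatest_nat[of ?P "[]" length "Suc (card V)"] bound by (metis (no_types, lifting) le_imp_less_Suc)
  have "u \<in> set (ws @ ps)" if "u \<in> V" "E (last (ws @ ps)) u" for u
  proof (rule ccontr)
    assume "u \<notin> set (ws @ ps)"
    then have "?P (ps @ [u])"
      using ps(1) that assms(5) unfolding append_assoc[symmetric]
      by (subst successively_append_iff) auto
    then show False using ps(2) by force
  qed
  then show ?thesis using that ps(1) by blast
qed

text \<open>
  Zajac's argument: grow a maximal path \<open>x, v, y, \<dots>\<close> from two non-adjacent neighbors \<open>x\<close>, \<open>y\<close> of \<open>v\<close>.
  If it is Hamiltonian, give \<open>x\<close> and \<open>y\<close> the same color and color greedily towards \<open>v\<close>. Otherwise its
  end closes a cycle; color the rest by induction and go around the cycle, so that the last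
  vertex again sees one color twice.
\<close>

theorem brooks:
  fixes E :: "'a \<Rightarrow> 'a \<Rightarrow> bool"
  assumes "finite V" "\<And>u v. E u v \<Longrightarrow> E v u" "\<And>u. \<not> E u u" "3 \<le> k"
    and "\<And>v. v \<in> V \<Longrightarrow> card {u \<in> V. E v u} \<le> k"
    and "\<not> (\<exists>K\<subseteq>V. card K = k + 1 \<and> (\<forall>u\<in>K. \<forall>v\<in>K. u \<noteq> v \<longrightarrow> E u v))"
  shows "\<exists>c. proper_on E k V c"
  using assms(1,5,6)
proof (induction V rule: finite_psubset_induct)
  case (psubset V)
  interpret bounded_degree_graph E V k
    by unfold_locales (fact psubset.hyps, fact assms(2), fact assms(3), fact psubset.prems(1))
  have IH: "\<exists>c. proper_on E k W c" if "W \<subset> V" for W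
  proof (rule psubset.IH[OF that])
    show "card {u \<in> W. E v u} \<le> k" if "v \<in> W" for v
    proof -
      have "card {u \<in> W. E v u} \<le> card {u \<in> V. E v u}"
        using \<open>W \<subset> V\<close> finV by (intro card_mono) auto
      also have "\<dots> \<le> k" using that \<open>W \<subset> V\<close> degE by blast
      finally show ?thesis .
    qed
    show "\<not> (\<exists>K\<subseteq>W. card K = k + 1 \<and> (\<forall>u\<in>K. \<forall>v\<in>K. u \<noteq> v \<longrightarrow> E u v))"
      using psubset.prems(2) that by (meson psubset_imp_subset subset_trans)
  qed
  show ?case
  \<comment> \<open>A vertex of degree below \<open>k\<close> can be removed and colored last;
    otherwise the graph is \<open>k\<close>-regular.\<close>
  proof (cases "\<exists>v\<in>V. card {u \<in> V. E v u} < k")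
    case True
    then obtain v where v: "v \<in> V" "card {u \<in> V. E v u} < k" by blast
    obtain c where c: "proper_on E k (V - {v}) c" using IH[of "V - {v}"] v by auto
    have "card (c ` {u \<in> V - {v}. E v u}) \<le> card {u \<in> V - {v}. E v u}"
      using finV by (intro card_image_le) auto
    also have "\<dots> \<le> card {u \<in> V. E v u}" using finV by (intro card_mono) auto
    finally have less: "card (c ` {u \<in> V - {v}. E v u}) < k" using v(2) by linarith
    obtain a where "proper_on E k (insert v (V - {v})) (c(v := a))"
      using extend_vertex[OF _ c less] by auto
    then show ?thesis using v(1) by (auto simp: insert_absorb)
  next
    case False
    then have reg: "card {u \<in> V. E v u} = k" if "v \<in> V" for v using degE[OF that] that by force
    show ?thesis
    proof (cases "V = {}")
      case True
      then show ?thesis by (simp add: proper_on_def)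
    next
      case False
      then obtain v where v: "v \<in> V" by blast
      let ?N = "{u \<in> V. E v u}"
      have "card (insert v ?N) = k + 1" using reg[OF v] finV irreflE by simp
      then have "\<not> (\<forall>x\<in>insert v ?N. \<forall>y\<in>insert v ?N. x \<noteq> y \<longrightarrow> E x y)"
        using psubset.prems(2) v by (metis (no_types, lifting) insert_subset mem_Collect_eq subsetI)
      then obtain x y where xy: "x \<in> ?N" "y \<in> ?N" "x \<noteq> y" "\<not> E x y"
        using symE by auto
      have "successively E [x, v, y]" "distinct [x, v, y]" "set [x, v, y] \<subseteq> V"
        using xy v symE irreflE by auto
      then obtain ps where ps: "successively E ([x, v, y] @ ps)" "distinct ([x, v, y] @ ps)"
        "set ([x, v, y] @ ps) \<subseteq> V"
        "\<And>u. u \<in> V \<Longrightarrow> E (last ([x, v, y] @ ps)) u \<Longrightarrow> u \<in> set ([x, v, y] @ ps)"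
        using maximal_path[OF finV] by (metis list.distinct(1))
      define P where "P = [x, v, y] @ ps"
      note P = ps[folded P_def]
      have PV: "set P \<subseteq> V" using P by simp
      show ?thesis
      proof (cases "set P = V")
        case True
        \<comment> \<open>As \<open>3 \<le> k\<close>, \<open>v\<close> has a third neighbor
          \<open>z\<close>. The stretch before \<open>z\<close> is colored first; then the path is
          followed backwards from its end to \<open>z\<close> and on to \<open>v\<close>, which sees
          \<open>x\<close> and \<open>y\<close> in color 1.\<close>
        have "\<not> ?N \<subseteq> {x, y}"
          using card_mono[of "{x, y}" ?N] reg[OF v] assms(4) by (auto simp: card_insert_if split: if_splits)
        then obtain z where z: "E v z" "z \<in> V" "z \<noteq> x" "z \<noteq> y" by blast
        then have "z \<in> set ps" using True irreflE by (auto simp: P_def)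
        then obtain as bs where ab: "ps = as @ z # bs" by (meson split_list)
        have sc: "successively E (as @ [z])" "successively E (z # bs)"
          using P(1) by (auto simp: P_def ab successively_append_iff successively_Cons)
        have c0: "proper_on E k {x, y} (\<lambda>_. 1)"
          using xy symE irreflE assms(4) by (auto simp: proper_on_def)
        obtain c where c: "proper_on E k ({x, y} \<union> set as) c" "\<forall>u\<in>{x, y}. c u = 1"
          using extend_path[of as z "{x, y}", OF sc(1) _ _ _ c0] P(2,3)
          by (auto simp: P_def ab)
        have s: "successively E ((rev bs @ [z]) @ [v])"
        proof -
          have "successively (\<lambda>x y. E y x) (z # bs)"
            using sc(2) symE by (auto elim: successively_mono)
          then have "successively E (rev (z # bs))" by (subst successively_rev)
          then show ?thesis using z(1) symE by (subst successively_append_iff) auto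
        qed
        have "\<exists>c'. proper_on E k (({x, y} \<union> set as) \<union> set ((rev bs @ [z]) @ [v])) c'"
          by (rule extend_path_closed[OF s _ _ _ c(1), of x y])
            (use P(2,3) xy c(2) in \<open>auto simp: P_def ab\<close>)
        moreover have "({x, y} \<union> set as) \<union> set ((rev bs @ [z]) @ [v]) = V"
          using True by (auto simp: P_def ab)
        ultimately show ?thesis by simp
      next
        case False
        define l where "l = last P"
        have lP: "l \<in> set P" "l \<in> V" using PV by (auto simp: l_def P_def)
        have "\<exists>u\<in>set P. E l u"
        proof -
          have "{u \<in> V. E l u} \<noteq> {}" using reg[OF lP(2)] assms(4) by (metis card.empty not_numeral_le_zero)
          then show ?thesis using P(4) by (auto simp: l_def)
        qed
        \<comment> \<open>Taking the first neighbor \<open>u\<close> of \<open>l\<close> on the path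
          makes the cycle \<open>C\<close> contain all neighbors of \<open>l\<close>.\<close>
        then obtain as u bs where C: "P = as @ u # bs" "E l u" "\<forall>w\<in>set as. \<not> E l w"
          using split_list_first_prop[of P "E l"] by blast
        define C where "C = u # bs"
        have P_C: "P = as @ C" by (simp add: C_def C)
        have sC: "successively E C" "distinct C" "set C \<subseteq> V" "C \<noteq> []" "last C = l"
          using P(1-3) by (auto simp: P_C successively_append_iff l_def C_def)
        have lC: "w \<in> set C" if "w \<in> V" "E l w" for w
          using P(4)[of w] that C(3) by (auto simp: P_C l_def)
        have proper: "set C \<subset> V" using False PV by (auto simp: P_C)
        have "u \<in> V \<inter> set C" using sC(3) by (auto simp: C_def)
        then have "V - set C \<subset> V" by blast
        then obtain c where c: "proper_on E k (V - set C) c" using IH by blast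
        show ?thesis
        proof (cases "\<exists>d\<in>set C. \<exists>w\<in>V - set C. E d w")
          case False
          obtain c' where "proper_on E k (set C) c'" using IH[OF proper] by blast
          then have "proper_on E k V (\<lambda>v. if v \<in> set C then c' v else c v)"
            using c False symE unfolding proper_on_def by auto
          then show ?thesis by blast
        next
          case True
          \<comment> \<open>\<open>d\<close> is the last vertex of \<open>C\<close> with a neighbor
            \<open>w\<close> outside. Its successor \<open>e\<close> has none and may copy the color
            of \<open>w\<close>; the tour from after \<open>e\<close> around to \<open>d\<close>
            then ends at a vertex seeing that color twice.\<close>
          then obtain cs d es where d: "C = cs @ d # es" "\<exists>w\<in>V - set C. E d w"
            "\<forall>e\<in>set es. \<not> (\<exists>w\<in>V - set C. E e w)"
            using split_list_last_prop[of C "\<lambda>d. \<exists>w\<in>V - set C. E d w"] by blast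
          then obtain w where w: "w \<in> V" "w \<notin> set C" "E d w" by blast
          have "es \<noteq> []" using lC w sC(5) d(1) by (auto split: if_splits)
          then obtain e fs where es: "es = e # fs" by (cases es) auto
          have e: "e \<in> V" "e \<in> set C" "\<not> (\<exists>w\<in>V - set C. E e w)" "E d e"
            using d sC es by (auto simp: successively_append_iff successively_Cons)
          have c1: "proper_on E k (insert e (V - set C)) (c(e := c w))"
            using c e w symE irreflE unfolding proper_on_def by auto
          have "successively E ((fs @ cs) @ [d])"
          proof -
            have 1: "successively E fs" "successively E (cs @ [d])"
              using sC(1) by (auto simp: d es successively_append_iff successively_Cons)
            moreover have "E (last fs) (hd (cs @ [d]))" if "fs \<noteq> []"
            proof -
              have "last fs = l" using sC(5) that by (simp add: d es)
              moreover have "hd (cs @ [d]) = u"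
                using d(1) by (cases cs) (auto simp: C_def)
              ultimately show ?thesis using C(2) by simp
            qed
            ultimately show ?thesis
              unfolding append_assoc by (subst successively_append_iff) blast
          qed
          then have "\<exists>c'. proper_on E k (insert e (V - set C) \<union> set ((fs @ cs) @ [d])) c'"
          proof (rule extend_path_closed[OF _ _ _ _ c1])
            show "distinct ((fs @ cs) @ [d])" "set ((fs @ cs) @ [d]) \<subseteq> V - insert e (V - set C)"
              using sC(2,3) by (auto simp: d es)
            show "E d e" "E d w" "e \<noteq> w" "(c(e := c w)) e = (c(e := c w)) w"
              using e w by auto
          qed (use e w in auto)
          moreover have "insert e (V - set C) \<union> set ((fs @ cs) @ [d]) = V"
            using sC by (auto simp: d es)
          ultimately show ?thesis by simp
        qed
      qed
    qed
  qed
qed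

section \<open>Local computability\<close>

text \<open>
  Everything a node can learn in \<open>t\<close> rounds, encoded as a number.
\<close>

primrec view :: "nat \<Rightarrow> port_graph \<Rightarrow> (nat \<Rightarrow> 'i::countable) \<Rightarrow> nat \<Rightarrow> nat" where
  "view 0 G x = (\<lambda>v. to_nat (degree G v, x v))"
| "view (Suc t) G x =
     (\<lambda>v. to_nat (view t G x v, map (\<lambda>u. (view t G x u, port_to G u v)) (G v)))"

text \<open>\<open>g\<close> is the same for all graphs and inputs but otherwise arbitrary, matching
  unrestricted internal computation. It may depend on \<open>n\<close> and on anything fixed in
  \<open>\<Phi>\<close>, such as a degree bound.\<close>

definition computable_in ::
  "nat \<Rightarrow> nat \<Rightarrow> (port_graph \<Rightarrow> (nat \<Rightarrow> 'i::countable) \<Rightarrow> nat \<Rightarrow> 'a) \<Rightarrow> bool" where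
  "computable_in n t \<Phi> \<longleftrightarrow> (\<exists>g. \<forall>G x v. is_graph n G \<longrightarrow> v < n \<longrightarrow> \<Phi> G x v = g (view t G x v))"

lemma computable_inI:
  assumes "\<And>G x v. is_graph n G \<Longrightarrow> v < n \<Longrightarrow> \<Phi> G x v = g (view t G x v)"
  shows "computable_in n t \<Phi>"
  using assms unfolding computable_in_def by blast

lemma computable_in_cong:
  assumes "computable_in n t \<Phi>" "\<And>G x v. is_graph n G \<Longrightarrow> v < n \<Longrightarrow> \<Psi> G x v = \<Phi> G x v"
  shows "computable_in n t \<Psi>"
  using assms unfolding computable_in_def by metis

lemma is_graph_less: "is_graph n G \<Longrightarrow> v < n \<Longrightarrow> u \<in> set (G v) \<Longrightarrow> u < n"
  unfolding is_graph_def by blast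

lemma is_graph_sym: "is_graph n G \<Longrightarrow> v < n \<Longrightarrow> u \<in> set (G v) \<Longrightarrow> v \<in> set (G u)"
  unfolding is_graph_def by blast

lemma computable_map:
  assumes "computable_in n t \<Phi>" shows "computable_in n t (\<lambda>G x v. h (\<Phi> G x v))"
proof -
  obtain g where "\<And>G x v. is_graph n G \<Longrightarrow> v < n \<Longrightarrow> \<Phi> G x v = g (view t G x v)"
    using assms unfolding computable_in_def by blast
  then show ?thesis by (intro computable_inI[where g = "\<lambda>w. h (g w)"]) simp
qed

lemma computable_map2:
  assumes "computable_in n t \<Phi>" "computable_in n t \<Psi>"
  shows "computable_in n t (\<lambda>G x v. h (\<Phi> G x v) (\<Psi> G x v))"
proof -
  obtain g g' where "\<And>G x v. is_graph n G \<Longrightarrow> v < n \<Longrightarrow> \<Phi> G x v = g (view t G x v)"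
    "\<And>G x v. is_graph n G \<Longrightarrow> v < n \<Longrightarrow> \<Psi> G x v = g' (view t G x v)"
    using assms unfolding computable_in_def by blast
  then show ?thesis by (intro computable_inI[where g = "\<lambda>w. h (g w) (g' w)"]) simp
qed

lemma computable_mono:
  assumes "computable_in n t \<Phi>" "t \<le> t'" shows "computable_in n t' \<Phi>"
proof -
  obtain g where g: "\<And>G x v. is_graph n G \<Longrightarrow> v < n \<Longrightarrow> \<Phi> G x v = g (view t G x v)"
    using assms unfolding computable_in_def by blast
  have "\<exists>f. \<forall>(G :: port_graph) x v. view t G (x :: nat \<Rightarrow> 'a) v = f (view t' G x v)"
    using \<open>t \<le> t'\<close>
  proof (induction t' rule: dec_induct)
    case base
    show ?case by (intro exI[of _ "\<lambda>w. w"]) simp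
  next
    case (step t')
    then obtain f where "\<And>(G :: port_graph) x v. view t G (x :: nat \<Rightarrow> 'a) v = f (view t' G x v)"
      by blast
    then show ?case
      by (intro exI[of _ "\<lambda>w. f (fst (from_nat w :: nat \<times> (nat \<times> nat) list))"]) simp
  qed
  then obtain f where "\<And>(G :: port_graph) x v. view t G (x :: nat \<Rightarrow> 'a) v = f (view t' G x v)"
    by blast
  then show ?thesis using g by (intro computable_inI[where g = "\<lambda>w. g (f w)"]) simp
qed

lemma computable_neighbors:
  assumes "computable_in n t \<Phi>"
  shows "computable_in n (Suc t) (\<lambda>G x v. map (\<lambda>u. (\<Phi> G x u, port_to G u v)) (G v))"
proof -
  obtain g where g: "\<And>G x v. is_graph n G \<Longrightarrow> v < n \<Longrightarrow> \<Phi> G x v = g (view t G x v)"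
    using assms unfolding computable_in_def by blast
  show ?thesis
    by (intro computable_inI[where
          g = "\<lambda>w. map (\<lambda>(y, p). (g y, p)) (snd (from_nat w :: nat \<times> (nat \<times> nat) list))"])
      (auto simp: g is_graph_less)
qed

lemma computable_neighbors':
  assumes "computable_in n t \<Phi>"
  shows "computable_in n (Suc t) (\<lambda>G x v. map (\<Phi> G x) (G v))"
  using computable_map[OF computable_neighbors[OF assms], of "map fst"] by (simp add: comp_def)

lemma computable_input: "computable_in n t (\<lambda>G x v. x v)"
proof -
  have "computable_in n 0 (\<lambda>G (x :: nat \<Rightarrow> 'a) v. x v)"
    by (rule computable_inI[where g = "\<lambda>w. snd (from_nat w :: nat \<times> 'a)"]) simp
  then show ?thesis by (rule computable_mono) simp
qed

lemma computable_degree: "computable_in n t (\<lambda>G (x :: nat \<Rightarrow> 'i::countable) v. degree G v)"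
proof -
  have "computable_in n 0 (\<lambda>G (x :: nat \<Rightarrow> 'i) v. degree G v)"
    by (rule computable_inI[where g = "\<lambda>w. fst (from_nat w :: nat \<times> 'i)"]) simp
  then show ?thesis by (rule computable_mono) simp
qed


text \<open>One round reads only the states of the neighbors and their ports towards
  \<open>v\<close>, and the next view records both.\<close>

lemma computable_state:
  fixes A :: "('i::countable) local_alg"
  shows "computable_in n t (\<lambda>G x. state A N D G x t)"
proof (induction t)
  case 0
  have "computable_in n 0 (\<lambda>G (x :: nat \<Rightarrow> 'i) v. init A N D (degree G v) (x v))"
    by (rule computable_map2[OF computable_degree computable_input])
  then show ?case by simp
next
  case (Suc t)
  have "computable_in n (Suc t) (\<lambda>G x v. (\<lambda>s ms. if result A s = None
      then receive A s (map (\<lambda>(s', p). outgoing A s' p) ms) else s)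
      (state A N D G x t v)
      (map (\<lambda>u. (state A N D G x t u, port_to G u v)) (G v)))"
    by (rule computable_map2[OF computable_mono[OF Suc] computable_neighbors[OF Suc]]) simp
  then show ?case by (rule computable_in_cong) (simp add: comp_def)
qed

section \<open>Realizing local functions by algorithms\<close>

text \<open>The state pairs the view with a round counter because termination is decided from the
  state alone. Messages carry their port number, since a view records the ports by which neighbors
  reach the node.\<close>

definition full_information_alg :: "nat \<Rightarrow> (nat \<Rightarrow> nat) \<Rightarrow> ('i::countable) local_alg" where
  "full_information_alg t g =
     \<lparr>init = (\<lambda>_ _ d i. to_nat (0 :: nat, to_nat (d, i))),
      send = (\<lambda>s p. to_nat (snd (from_nat s :: nat \<times> nat), p)),
      receive = (\<lambda>s ms. case from_nat s of (i :: nat, w :: nat) \<Rightarrow>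
        to_nat (Suc i, to_nat (w, map (\<lambda>m. from_nat (the m) :: nat \<times> nat) ms))),
      result = (\<lambda>s. case from_nat s of (i :: nat, w) \<Rightarrow> if t \<le> i then Some (g w) else None)\<rparr>"

lemma state_full_information_alg:
  "i \<le> t \<Longrightarrow> state (full_information_alg t g) n D G x i v = to_nat (i, view i G x v)"
proof (induction i arbitrary: v)
  case (Suc i)
  then have "state (full_information_alg t g) n D G x i = (\<lambda>v. to_nat (i, view i G x v))" by auto
  then show ?case using Suc.prems
    by (simp add: full_information_alg_def outgoing_def comp_def)
qed (simp add: full_information_alg_def)

text \<open>Converse of \<open>computable_state\<close>: gather the view for \<open>t\<close>
  rounds, then apply \<open>g\<close>. Algorithms may hence be designed as compositions of local
  functions.\<close>

lemma implement_computable: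
  fixes \<Phi> :: "port_graph \<Rightarrow> (nat \<Rightarrow> 'i::countable) \<Rightarrow> nat \<Rightarrow> nat"
  assumes "computable_in n t \<Phi>"
  obtains A where
    "\<And>D G x. is_graph n G \<Longrightarrow> running_time A n D G x \<le> enat t"
    "\<And>k D G x. is_graph n G \<Longrightarrow> proper_coloring k n G (\<Phi> G x) \<Longrightarrow> colors_properly k A n D G x"
proof -
  obtain g where g: "\<And>G x v. is_graph n G \<Longrightarrow> v < n \<Longrightarrow> \<Phi> G x v = g (view t G x v)"
    using assms unfolding computable_in_def by blast
  define A :: "'i local_alg" where "A = full_information_alg t g"
  have res: "result A (state A n D G x t v) = Some (\<Phi> G x v)" if "is_graph n G" "v < n" for D G x v
    using g[OF that] by (simp add: A_def state_full_information_alg) (simp add: full_information_alg_def)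
  have trm: "terminated A n D G x t" if "is_graph n G" for D G x
    using res[OF that] unfolding terminated_def by simp
  show ?thesis
  proof
    show "running_time A n D G x \<le> enat t" if "is_graph n G" for D G x
      unfolding running_time_def using trm[OF that] by (intro INF_lower) simp
    show "colors_properly k A n D G x" if "is_graph n G" "proper_coloring k n G (\<Phi> G x)" for k D G x
      unfolding colors_properly_def
      using trm[OF that(1)] that(2) res[OF that(1)] is_graph_less[OF that(1)]
      by (intro exI[of _ t]) (auto simp: proper_coloring_def)
  qed
qed

section \<open>Optimal algorithms and their outputs\<close>

lemma state_after_termination:
  assumes "terminated A n D G x t" "t \<le> t'" "v < n"
  shows "state A n D G x t' v = state A n D G x t v"
  using assms(2)
proof (induction t' rule: dec_induct)
  case (step t')
  then show ?case using assms unfolding terminated_def by auto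
qed simp

text \<open>\<open>enat\<close> is well-ordered, and a finite bound rules out an empty
  \<open>S\<close>. This turns a finite complexity into an optimal algorithm.\<close>

lemma INF_enat_attained:
  fixes f :: "'a \<Rightarrow> enat"
  assumes "(INF a\<in>S. f a) \<le> enat T"
  obtains a where "a \<in> S" "f a \<le> enat T"
proof -
  have "f ` S \<noteq> {}" using assms by (auto simp: Inf_enat_def)
  then have "(INF a\<in>S. f a) \<in> f ` S" by (meson Inf_enat_def wellorder_InfI all_not_in_conv)
  then show ?thesis using assms that by auto
qed

lemma running_time_terminated:
  assumes "running_time A n D G x \<le> enat T"
  shows "terminated A n D G x T"
proof -
  obtain t where t: "t \<in> {t. terminated A n D G x t}" "enat t \<le> enat T"
    using assms unfolding running_time_def by (rule INF_enat_attained)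
  then have "terminated A n D G x t" "t \<le> T" by simp_all
  then show ?thesis using state_after_termination[of A n D G x t T] unfolding terminated_def by simp
qed

text \<open>All nodes are read in a common round \<open>T\<close>; states freeze on termination, so
  any \<open>T\<close> bounding the running time shows the final outputs.\<close>

definition output_at :: "'i local_alg \<Rightarrow> nat \<Rightarrow> nat \<Rightarrow> port_graph \<Rightarrow> (nat \<Rightarrow> 'i) \<Rightarrow> nat \<Rightarrow> nat \<Rightarrow> nat" where
  "output_at A n D G x T v = the (result A (state A n D G x T v))"

lemma colors_properly_output_at:
  assumes "is_graph n G" "colors_properly k A n D G x" "running_time A n D G x \<le> enat T"
  shows "proper_coloring k n G (output_at A n D G x T)"
proof -
  obtain t where t: "terminated A n D G x t"
    "proper_coloring k n G (\<lambda>v. the (result A (state A n D G x t v)))"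
    using assms(2) unfolding colors_properly_def by blast
  have "state A n D G x t v = state A n D G x T v" if "v < n" for v
    using state_after_termination[OF t(1) _ that]
      state_after_termination[OF running_time_terminated[OF assms(3)] _ that]
    by (metis nat_le_linear)
  then show ?thesis using t(2) is_graph_less[OF assms(1)]
    unfolding proper_coloring_def output_at_def by simp
qed

section \<open>Running algorithms on computed induced subgraphs\<close>

definition restrict_graph :: "port_graph \<Rightarrow> (nat \<Rightarrow> bool) \<Rightarrow> port_graph" where
  "restrict_graph G m = (\<lambda>v. if m v then filter m (G v) else [])"

lemma restrict_graph_True [simp]: "restrict_graph G (\<lambda>_. True) = G"
  by (auto simp: restrict_graph_def)

lemma port_to_split:
  assumes "G u = ys @ v # zs" "v \<notin> set ys" "v \<notin> set zs"
  shows "port_to G u v = length ys"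
  unfolding port_to_def
proof (rule the_equality)
  fix p assume p: "p < length (G u) \<and> G u ! p = v"
  show "p = length ys"
  proof (rule ccontr)
    assume "p \<noteq> length ys"
    then have "G u ! p \<in> set ys \<or> G u ! p \<in> set zs"
      using p assms(1) by (cases "p < length ys") (auto simp: nth_append nth_Cons')
    then show False using p assms by auto
  qed
qed (use assms in auto)

text \<open>Surviving ports keep their order, so the new number counts the survivors before the old
  port. This form is computable from the marks on the ports of \<open>u\<close>.\<close>

lemma port_to_restrict_graph:
  assumes "is_graph n G" "v < n" "u \<in> set (G v)" "m u" "m v"
  shows "port_to (restrict_graph G m) u v =
    length (filter id (take (port_to G u v) (map m (G u))))"
proof -
  have "v \<in> set (G u)" using is_graph_sym assms by blast
  moreover have "distinct (G u)"
    using assms is_graph_less[OF assms(1-3)] by (auto simp: is_graph_def)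
  ultimately obtain ys zs where G: "G u = ys @ v # zs" "v \<notin> set ys" "v \<notin> set zs"
    by (metis distinct.simps(2) distinct_append not_distinct_conv_prefix split_list_first)
  have "port_to (restrict_graph G m) u v = length (filter m ys)"
    by (rule port_to_split[where zs = "filter m zs"]) (use G assms in \<open>auto simp: restrict_graph_def\<close>)
  moreover have "port_to G u v = length ys" using port_to_split[of G, OF G] .
  ultimately show ?thesis using G by (simp add: filter_map comp_def)
qed

text \<open>
  Nodes outside \<open>m\<close> take part as isolated nodes, which keeps the number of nodes at \<open>n\<close>. The extra
  round tells every node which of its ports survive.
\<close>

lemma computable_restricted_view:
  fixes m :: "port_graph \<Rightarrow> (nat \<Rightarrow> 'i::countable) \<Rightarrow> nat \<Rightarrow> bool"
    and y :: "port_graph \<Rightarrow> (nat \<Rightarrow> 'i) \<Rightarrow> nat \<Rightarrow> 'j::countable"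
  assumes m: "computable_in n s m" and y: "computable_in n s y"
  shows "computable_in n (Suc s + i) (\<lambda>G x. view i (restrict_graph G (m G x)) (y G x))"
proof (induction i)
  case 0
  have pair: "computable_in n (Suc s) (\<lambda>G x v. (m G x v, map (m G x) (G v)))"
    by (rule computable_map2[OF computable_mono[OF m] computable_neighbors'[OF m]]) simp
  have "computable_in n (Suc s) (\<lambda>G x v. (\<lambda>(b, ms) a. to_nat (if b then length (filter id ms) else 0, a))
     (m G x v, map (m G x) (G v)) (y G x v))"
    by (rule computable_map2[OF pair computable_mono[OF y]]) simp
  then have "computable_in n (Suc s) (\<lambda>G x. view 0 (restrict_graph G (m G x)) (y G x))"
    by (rule computable_in_cong) (auto simp: degree_def restrict_graph_def filter_map comp_def)
  then show ?case by simp
next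
  case (Suc i)
  let ?v = "\<lambda>G x. view i (restrict_graph G (m G x)) (y G x)"
  let ?t = "Suc s + i"
  have "computable_in n ?t (\<lambda>G x v. (map (m G x) (G v), m G x v))"
    by (rule computable_map2[OF computable_mono[OF computable_neighbors'[OF m]] computable_mono[OF m]])
      simp_all
  \<comment> \<open>A neighbor also reports the marks on its ports, from which the receiver computes
    the new number of the port leading to it.\<close>
  then have triple: "computable_in n ?t (\<lambda>G x v. (?v G x v, map (m G x) (G v), m G x v))"
    by (rule computable_map2[OF Suc])
  have "computable_in n (Suc ?t) (\<lambda>G x v. (\<lambda>(w, _, b) L. to_nat (w,
      if b then map (\<lambda>((w, f, _), p). (w, length (filter id (take p f)))) (filter (\<lambda>((_, _, b), _). b) L)
      else []))
     (?v G x v, map (m G x) (G v), m G x v)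
     (map (\<lambda>u. ((?v G x u, map (m G x) (G u), m G x u), port_to G u v)) (G v)))"
    by (rule computable_map2[OF computable_mono[OF triple] computable_neighbors[OF triple]]) simp
  then have "computable_in n (Suc ?t) (\<lambda>G x. view (Suc i) (restrict_graph G (m G x)) (y G x))"
  proof (rule computable_in_cong, goal_cases)
    case (1 G x v)
    have H: "restrict_graph G (m G x) v = (if m G x v then filter (m G x) (G v) else [])"
      by (simp add: restrict_graph_def)
    show ?case using port_to_restrict_graph[OF 1]
      by (auto simp: H filter_map comp_def)
  qed
  then show ?case by simp
qed

lemma computable_compose_restricted:
  fixes \<Phi> :: "port_graph \<Rightarrow> (nat \<Rightarrow> 'j::countable) \<Rightarrow> nat \<Rightarrow> 'a"
  assumes "computable_in n s m" "computable_in n s y" "computable_in n t \<Phi>"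
    and "\<And>G x. is_graph n G \<Longrightarrow> is_graph n (restrict_graph G (m G x))"
  shows "computable_in n (Suc s + t) (\<lambda>G x. \<Phi> (restrict_graph G (m G x)) (y G x))"
proof -
  obtain g where g: "\<And>G x v. is_graph n G \<Longrightarrow> v < n \<Longrightarrow> \<Phi> G x v = g (view t G x v)"
    using assms(3) unfolding computable_in_def by blast
  show ?thesis
    by (rule computable_in_cong[OF computable_map[OF computable_restricted_view[OF assms(1,2)], where h = g]])
      (simp add: g assms(4))
qed

lemma is_graph_restrict_graph: "is_graph n G \<Longrightarrow> is_graph n (restrict_graph G m)"
  unfolding is_graph_def restrict_graph_def by auto

lemma computable_compose:
  fixes \<Phi> :: "port_graph \<Rightarrow> (nat \<Rightarrow> 'j::countable) \<Rightarrow> nat \<Rightarrow> 'a"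
    and y :: "port_graph \<Rightarrow> (nat \<Rightarrow> 'i::countable) \<Rightarrow> nat \<Rightarrow> 'j"
  assumes "computable_in n s y" "computable_in n t \<Phi>"
  shows "computable_in n (Suc s + t) (\<lambda>G x. \<Phi> G (y G x))"
proof -
  have "computable_in n s (\<lambda>G (x :: nat \<Rightarrow> 'i) v. True)"
    by (rule computable_map[OF computable_input, where h = "\<lambda>_. True"])
  from computable_compose_restricted[OF this assms] show ?thesis by simp
qed

section \<open>Balls and dependence on the input\<close>

primrec reach :: "port_graph \<Rightarrow> nat \<Rightarrow> nat \<Rightarrow> nat \<Rightarrow> bool" where
  "reach G 0 = (\<lambda>u v. u = v)"
| "reach G (Suc r) = (\<lambda>u v. reach G r u v \<or> (\<exists>w\<in>set (G u). reach G r w v))"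

lemma reach_mono:
  assumes "reach G r u v" "r \<le> s" shows "reach G s u v"
  using assms(2,1) by (induction s rule: dec_induct) auto

lemma reach_refl [simp]: "reach G r v v"
  using reach_mono[of G 0 v v r] by simp

lemma reach_trans: "reach G r u v \<Longrightarrow> reach G s v w \<Longrightarrow> reach G (r + s) u w"
proof (induction r arbitrary: u)
  case 0
  then show ?case by auto
next
  case (Suc r)
  then show ?case by auto
qed

lemma reach_edge: "u \<in> set (G v) \<Longrightarrow> reach G 1 v u"
  by auto

lemma reach_Suc_right: "reach G (Suc r) u v \<longleftrightarrow> reach G r u v \<or> (\<exists>w. reach G r u w \<and> v \<in> set (G w))"
proof
  show "reach G (Suc r) u v \<Longrightarrow> reach G r u v \<or> (\<exists>w. reach G r u w \<and> v \<in> set (G w))"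
  proof (induction r arbitrary: u)
    case (Suc r)
    from Suc.prems consider "reach G (Suc r) u v" | w where "w \<in> set (G u)" "reach G (Suc r) w v"
      by (simp only: reach.simps(2)[of G "Suc r"]) blast
    then show ?case
    proof cases
      case 2
      then show ?thesis using Suc.IH[of w] by auto
    qed simp
  qed auto
next
  assume "reach G r u v \<or> (\<exists>w. reach G r u w \<and> v \<in> set (G w))"
  then show "reach G (Suc r) u v"
    using reach_mono[of G r u v "Suc r"] reach_trans[of G r u _ 1 v] reach_edge by auto
qed

lemma reach_less: "is_graph n G \<Longrightarrow> u < n \<Longrightarrow> reach G r u v \<Longrightarrow> v < n"
  by (induction r arbitrary: u) (auto dest: is_graph_less)

lemma reach_sym: "is_graph n G \<Longrightarrow> u < n \<Longrightarrow> reach G r u v \<Longrightarrow> reach G r v u"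
proof (induction r arbitrary: u)
  case (Suc r)
  then consider "reach G r u v" | w where "w \<in> set (G u)" "reach G r w v" by auto
  then show ?case
  proof cases
    case 2
    then have "reach G r v w" "u \<in> set (G w)" using Suc is_graph_less is_graph_sym by blast+
    then show ?thesis using reach_trans[of G r v w 1 u] reach_edge by fastforce
  qed (use Suc in auto)
qed auto

lemma view_cong: "(\<And>u. reach G t v u \<Longrightarrow> x u = x' u) \<Longrightarrow> view t G x v = view t G x' v"
proof (induction t arbitrary: v)
  case (Suc t)
  have "view t G x v = view t G x' v" using Suc.prems by (intro Suc.IH) simp
  moreover have "view t G x u = view t G x' u" if "u \<in> set (G v)" for u
    using that Suc.prems by (intro Suc.IH) auto
  ultimately show ?case by simp
qed simp

lemma computable_locality:
  assumes "computable_in n t \<Phi>" "is_graph n G" "v < n" "\<And>u. reach G t v u \<Longrightarrow> x u = x' u"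
  shows "\<Phi> G x v = \<Phi> G x' v"
proof -
  obtain g where g: "\<And>G x v. is_graph n G \<Longrightarrow> v < n \<Longrightarrow> \<Phi> G x v = g (view t G x v)"
    using assms(1) unfolding computable_in_def by blast
  show ?thesis using g[OF assms(2,3)] view_cong[OF assms(4)] by simp
qed

text \<open>The flag is flooded for \<open>r\<close> further rounds, one edge per round.\<close>

lemma computable_within:
  assumes "computable_in n t P"
  shows "computable_in n (t + r) (\<lambda>G x v. \<exists>u. reach G r v u \<and> P G x u)"
proof (induction r)
  case 0
  then show ?case using assms by simp
next
  case (Suc r)
  let ?Q = "\<lambda>G x v. \<exists>u. reach G r v u \<and> P G x u"
  have "computable_in n (Suc (t + r)) (\<lambda>G x v. (\<lambda>b bs. b \<or> True \<in> set bs) (?Q G x v) (map (?Q G x) (G v)))"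
    by (rule computable_map2[OF computable_mono[OF Suc] computable_neighbors'[OF Suc]]) simp
  then have "computable_in n (Suc (t + r)) (\<lambda>G x v. \<exists>u. reach G (Suc r) v u \<and> P G x u)"
    by (rule computable_in_cong) (auto simp: image_iff)
  then show ?case by simp
qed

section \<open>Color reduction and the deterministic bound\<close>

lemma max_degree_le_iff: "1 \<le> n \<Longrightarrow> max_degree n G \<le> D \<longleftrightarrow> (\<forall>v<n. length (G v) \<le> D)"
  unfolding max_degree_def degree_def by (subst Max_le_iff) (auto simp: lessThan_empty_iff)

lemma colorable_clique_free:
  assumes n: "1 \<le> n" and k: "3 \<le> k" and G: "G \<in> graphs n k" and free: "clique_free (k + 1) n G"
  shows "colorable k n G"
proof -
  have graph: "is_graph n G" and len: "\<And>v. v < n \<Longrightarrow> length (G v) \<le> k"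
    using G max_degree_le_iff[OF n] by (auto simp: graphs_def)
  \<comment> \<open>Values of \<open>G\<close> outside \<open>{..<n}\<close> are arbitrary, so both
    endpoints are required to be nodes; this makes the relation symmetric and irreflexive on the
    whole type.\<close>
  let ?E = "\<lambda>u v. u < n \<and> v < n \<and> u \<in> set (G v)"
  have "\<exists>c. proper_on ?E k {..<n} c"
  proof (rule brooks)
    show "?E v u" if "?E u v" for u v using that is_graph_sym[OF graph] by blast
    show "\<not> ?E u u" for u using graph unfolding is_graph_def by blast
    show "card {u \<in> {..<n}. ?E v u} \<le> k" if "v \<in> {..<n}" for v
    proof -
      have "{u \<in> {..<n}. ?E v u} \<subseteq> set (G v)" using graph unfolding is_graph_def by auto
      then have "card {u \<in> {..<n}. ?E v u} \<le> card (set (G v))" by (intro card_mono) auto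
      also have "\<dots> \<le> k" using that len[of v] card_length[of "G v"] by simp
      finally show ?thesis .
    qed
    show "\<not> (\<exists>K\<subseteq>{..<n}. card K = k + 1 \<and> (\<forall>u\<in>K. \<forall>v\<in>K. u \<noteq> v \<longrightarrow> ?E u v))"
      using free unfolding clique_free_def by meson
  qed (use k in auto)
  then obtain c where c: "proper_on ?E k {..<n} c" by blast
  have "proper_coloring k n G c"
    using c is_graph_less[OF graph] unfolding proper_coloring_def proper_on_def by auto
  then show ?thesis unfolding colorable_def by blast
qed

primrec reduce_colors ::
  "port_graph \<Rightarrow> nat \<Rightarrow> nat \<Rightarrow> (nat \<Rightarrow> nat) \<Rightarrow> nat \<Rightarrow> nat \<Rightarrow> nat" where
  "reduce_colors G f k c 0 = c"
| "reduce_colors G f k c (Suc i) = (\<lambda>v. let d = reduce_colors G f k c i;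
     free = {1..f} - set (map d (G v)) in
     if d v = k - i \<and> free \<noteq> {} then Min free else d v)"

text \<open>A node of the current class keeps its color only when no replacement is free. It stays
  blocked, because colors in \<open>{1..f}\<close> lie below all treated classes and never change
  again.\<close>

lemma reduce_colors_proper:
  assumes graph: "is_graph n G" and c: "proper_coloring k n G c" and "f + i \<le> k"
  defines "d \<equiv> reduce_colors G f k c"
  shows "proper_coloring k n G (d i) \<and> (\<forall>v<n. k - i < d i v \<longrightarrow> {1..f} \<subseteq> d i ` set (G v))"
  using assms(3)
proof (induction i)
  case 0
  then show ?case using c by (auto simp: d_def proper_coloring_def)
next
  case (Suc i)
  define free where "free v = {1..f} - set (map (d i) (G v))" for v
  define P where "P v \<longleftrightarrow> d i v = k - i \<and> free v \<noteq> {}" for v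
  have step: "d (Suc i) v = (if P v then Min (free v) else d i v)" for v
    by (simp add: d_def free_def P_def Let_def)
  have IH: "proper_coloring k n G (d i)" "\<And>v. v < n \<Longrightarrow> k - i < d i v \<Longrightarrow> {1..f} \<subseteq> d i ` set (G v)"
    using Suc by auto
  have min: "Min (free v) \<in> {1..f}" "Min (free v) \<notin> d i ` set (G v)" if "P v" for v
    using Min_in[of "free v"] that unfolding P_def by (auto simp: free_def)
  have fk: "f < k - i" "k - i \<le> k" "f \<le> k" using Suc.prems by auto
  have range: "d (Suc i) v \<in> {1..k}" if "v < n" for v
    using min(1)[of v] that IH(1) fk(3) by (auto simp: step proper_coloring_def)
  have "d (Suc i) u \<noteq> d (Suc i) v" if "v < n" "u \<in> set (G v)" for u v
  proof -
    have u: "u < n" "v \<in> set (G u)" using that is_graph_less[OF graph] is_graph_sym[OF graph] by blast+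
    have "d i u \<noteq> d i v" using IH(1) that by (auto simp: proper_coloring_def)
    \<comment> \<open>Two adjacent nodes moving at once would share the color
      \<open>k - i\<close>.\<close>
    moreover have "\<not> (P u \<and> P v)" using \<open>d i u \<noteq> d i v\<close> by (auto simp: P_def)
    ultimately show ?thesis
      using min(2)[of u] min(2)[of v] imageI[OF that(2), of "d i"] imageI[OF u(2), of "d i"]
      by (auto simp: step)
  qed
  moreover have "{1..f} \<subseteq> d (Suc i) ` set (G v)" if v: "v < n" "k - Suc i < d (Suc i) v" for v
  proof -
    have "\<not> P v" using min(1)[of v] v(2) fk Suc.prems by (auto simp: step split: if_splits)
    then have dv: "d (Suc i) v = d i v" by (simp add: step)
    have "{1..f} \<subseteq> d i ` set (G v)"
    proof (cases "d i v = k - i")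
      case True
      then show ?thesis using \<open>\<not> P v\<close> by (auto simp: P_def free_def)
    next
      case False
      then show ?thesis using IH(2) v dv by auto
    qed
    moreover have "d (Suc i) u = d i u" if "d i u \<in> {1..f}" for u
      using that fk(1) by (auto simp: step P_def)
    ultimately show ?thesis
    proof (intro subsetI)
      fix a assume "{1..f} \<subseteq> d i ` set (G v)" and
        eq: "\<And>u. d i u \<in> {1..f} \<Longrightarrow> d (Suc i) u = d i u" and "a \<in> {1..f}"
      then obtain u where "u \<in> set (G v)" "a = d i u" by blast
      then show "a \<in> d (Suc i) ` set (G v)" using eq[of u] \<open>a \<in> {1..f}\<close> by (intro image_eqI) auto
    qed
  qed
  ultimately show ?case using range by (auto simp: proper_coloring_def)
qed

lemma computable_reduce_colors:
  assumes "computable_in n t c"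
  shows "computable_in n (t + i) (\<lambda>G x. reduce_colors G f k (c G x) i)"
proof (induction i)
  case (Suc i)
  let ?d = "\<lambda>G x. reduce_colors G f k (c G x) i"
  have "computable_in n (Suc (t + i)) (\<lambda>G x v.
      (\<lambda>a as. if a = k - i \<and> {1..f} - set as \<noteq> {} then Min ({1..f} - set as) else a)
      (?d G x v) (map (?d G x) (G v)))"
    by (rule computable_map2[OF computable_mono[OF Suc] computable_neighbors'[OF Suc]]) simp
  then have "computable_in n (Suc (t + i)) (\<lambda>G x. reduce_colors G f k (c G x) (Suc i))"
    by (rule computable_in_cong) (simp add: Let_def)
  then show ?case by simp
qed (use assms in simp)

definition uncolored_part :: "port_graph \<Rightarrow> nat \<Rightarrow> (nat \<Rightarrow> nat) \<Rightarrow> port_graph" where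
  "uncolored_part G f d = restrict_graph G (\<lambda>v. f < d v)"

text \<open>The \<open>k + 1\<close> rounds treat exactly the colors above \<open>D - k\<close>, so
  every node still above is blocked. At \<open>D = k\<close> there is no replacement color and
  nothing changes.\<close>

lemma uncolored_part:
  assumes n: "1 \<le> n" and k: "3 \<le> k" "k \<le> D" and G: "G \<in> graphs n D" "clique_free (k + 1) n G"
    and c: "proper_coloring (D + 1) n G c"
  defines "d \<equiv> reduce_colors G (D - k) (D + 1) c (k + 1)"
  defines "H \<equiv> uncolored_part G (D - k) d"
  shows "H \<in> graphs n k" "colorable k n H"
    and "proper_coloring k n H e \<Longrightarrow>
      proper_coloring D n G (\<lambda>v. if d v \<le> D - k then d v else D - k + e v)"
proof -
  let ?f = "D - k"
  have graph: "is_graph n G" and len: "\<And>v. v < n \<Longrightarrow> length (G v) \<le> D"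
    using G max_degree_le_iff[OF n] by (auto simp: graphs_def)
  have d: "proper_coloring (D + 1) n G d" "\<And>v. v < n \<Longrightarrow> ?f < d v \<Longrightarrow> {1..?f} \<subseteq> d ` set (G v)"
    using reduce_colors_proper[OF graph c, of ?f "k + 1"] k by (auto simp: d_def)
  have H: "is_graph n H" using graph unfolding H_def uncolored_part_def by (rule is_graph_restrict_graph)
  have "length (H v) \<le> k" if v: "v < n" for v
  proof (cases "?f < d v")
    case True
    \<comment> \<open>The replacement colors all appear on neighbors that leave the graph, so at
      least \<open>D - k\<close> neighbors are lost.\<close>
    have "{1..?f} \<subseteq> d ` set (filter (\<lambda>u. \<not> ?f < d u) (G v))"
    proof
      fix a assume a: "a \<in> {1..?f}"
      then obtain u where "u \<in> set (G v)" "a = d u" using d(2)[OF v True] by blast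
      then show "a \<in> d ` set (filter (\<lambda>u. \<not> ?f < d u) (G v))" using a by auto
    qed
    then have "card {1..?f} \<le> card (set (filter (\<lambda>u. \<not> ?f < d u) (G v)))"
      by (intro surj_card_le) auto
    also have "\<dots> \<le> length (filter (\<lambda>u. \<not> ?f < d u) (G v))" by (rule card_length)
    finally have "?f + length (filter (\<lambda>u. ?f < d u) (G v)) \<le> length (G v)"
      using sum_length_filter_compl[of "\<lambda>u. ?f < d u" "G v"] by simp
    then show ?thesis using True len[OF v] k by (simp add: H_def uncolored_part_def restrict_graph_def)
  qed (simp add: H_def uncolored_part_def restrict_graph_def)
  then show Hk: "H \<in> graphs n k" using H max_degree_le_iff[OF n] by (auto simp: graphs_def)
  have "clique_free (k + 1) n H"
    unfolding clique_free_def
  proof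
    assume "\<exists>K\<subseteq>{..<n}. card K = k + 1 \<and> (\<forall>u\<in>K. \<forall>v\<in>K. u \<noteq> v \<longrightarrow> u \<in> set (H v))"
    moreover have "set (H v) \<subseteq> set (G v)" for v
      by (auto simp: H_def uncolored_part_def restrict_graph_def)
    ultimately have "\<exists>K\<subseteq>{..<n}. card K = k + 1 \<and> (\<forall>u\<in>K. \<forall>v\<in>K. u \<noteq> v \<longrightarrow> u \<in> set (G v))"
      by (meson subsetD)
    then show False using G(2) unfolding clique_free_def by blast
  qed
  then show "colorable k n H" using colorable_clique_free n k Hk by blast
  show "proper_coloring D n G (\<lambda>v. if d v \<le> ?f then d v else ?f + e v)"
    if e: "proper_coloring k n H e"
    unfolding proper_coloring_def
  proof (intro conjI allI impI ballI)
    show "(if d v \<le> ?f then d v else ?f + e v) \<in> {1..D}" if "v < n" for v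
      using that d(1) e k by (auto simp: proper_coloring_def)
    fix v u assume v: "v < n" "u \<in> set (G v)"
    then have u: "u < n" using is_graph_less[OF graph] by blast
    have "d u \<noteq> d v" using d(1) v by (auto simp: proper_coloring_def)
    moreover have "1 \<le> e v" "1 \<le> e u" using e v u by (auto simp: proper_coloring_def)
    moreover have "e u \<noteq> e v" if "?f < d u" "?f < d v"
      using e v that by (auto simp: proper_coloring_def H_def uncolored_part_def restrict_graph_def)
    ultimately show "(if d u \<le> ?f then d u else ?f + e u) \<noteq> (if d v \<le> ?f then d v else ?f + e v)"
      by auto
  qed
qed

section \<open>The two-phase coloring\<close>

lemma computable_output_at:
  fixes A :: "('i::countable) local_alg"
  shows "computable_in n T (\<lambda>G x. output_at A n D G x T)"
  unfolding output_at_def by (rule computable_map[OF computable_state])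

definition leftover ::
  "nat \<Rightarrow> nat \<Rightarrow> nat \<Rightarrow> 'a local_alg \<Rightarrow> nat \<Rightarrow> port_graph \<Rightarrow> (nat \<Rightarrow> 'a) \<Rightarrow> nat \<Rightarrow> nat" where
  "leftover n k D A T G x = reduce_colors G (D - k) (D + 1) (output_at A n D G x T) (k + 1)"

text \<open>The phases have separate inputs: the same identifiers twice in the deterministic case,
  disjoint parts of the bit strings in the randomized one.\<close>

definition two_phase ::
  "nat \<Rightarrow> nat \<Rightarrow> nat \<Rightarrow> 'a local_alg \<Rightarrow> nat \<Rightarrow> 'b local_alg \<Rightarrow> nat \<Rightarrow>
    port_graph \<Rightarrow> (nat \<Rightarrow> 'a) \<Rightarrow> (nat \<Rightarrow> 'b) \<Rightarrow> nat \<Rightarrow> nat" where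
  "two_phase n k D A T B T' G x y = (let d = leftover n k D A T G x in
     (\<lambda>v. if d v \<le> D - k then d v
          else D - k + output_at B n k (uncolored_part G (D - k) d) y T' v))"

text \<open>The first coloring takes \<open>Suc T\<close> rounds, the reduction
  \<open>k + 1\<close>, announcing the leftover nodes one, and the second coloring
  \<open>T'\<close>.\<close>

lemma computable_two_phase:
  fixes A :: "('a::countable) local_alg" and B :: "('b::countable) local_alg"
    and p :: "'i::countable \<Rightarrow> 'a" and q :: "'i \<Rightarrow> 'b"
  shows "computable_in n (T + k + T' + 3)
    (\<lambda>G x. two_phase n k D A T B T' G (\<lambda>v. p (x v)) (\<lambda>v. q (x v)))"
proof -
  have p: "computable_in n 0 (\<lambda>G x v. p (x v))" and q: "computable_in n 0 (\<lambda>G x v. q (x v))"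
    by (rule computable_map[OF computable_input])+
  have "computable_in n 0 (\<lambda>G (x :: nat \<Rightarrow> 'i) v. True)"
    by (rule computable_map[OF computable_input, where h = "\<lambda>_. True"])
  from computable_compose_restricted[OF this p computable_output_at, of T A D]
  have "computable_in n (Suc T) (\<lambda>G x. output_at A n D G (\<lambda>v. p (x v)) T)" by simp
  from computable_reduce_colors[OF this, of "k + 1"]
  have d: "computable_in n (T + k + 2) (\<lambda>G x. leftover n k D A T G (\<lambda>v. p (x v)))" (is "computable_in n _ ?d")
    by (simp add: leftover_def)
  from computable_compose_restricted[OF computable_map[OF d, of "\<lambda>a. D - k < a"] computable_mono[OF q]
      computable_output_at, of T' B k]
  have "computable_in n (T + k + T' + 3) (\<lambda>G x. output_at B n k (uncolored_part G (D - k) (?d G x)) (\<lambda>v. q (x v)) T')"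
    by (simp add: uncolored_part_def is_graph_restrict_graph ac_simps numeral_3_eq_3)
  from computable_map2[OF computable_mono[OF d] this, of "\<lambda>a b. if a \<le> D - k then a else D - k + b"]
  show ?thesis by (simp add: two_phase_def Let_def)
qed

text \<open>Identifiers stay valid in the second phase because the leftover graph is again regarded
  as a graph on \<open>n\<close> nodes.\<close>

lemma deterministic_bound:
  assumes n: "1 \<le> n" and k: "3 \<le> k" "k \<le> D"
  shows "T_Delta_col_clique_free idb k n D
    \<le> 2 * (T_Delta_plus_one_col idb n D + enat k + T_Delta_col idb n k)"
proof (cases "T_Delta_plus_one_col idb n D = \<infinity> \<or> T_Delta_col idb n k = \<infinity>")
  case True
  then show ?thesis by (auto simp: imult_is_infinity numeral_eq_enat)
next
  case False
  then obtain T T' where T: "T_Delta_plus_one_col idb n D = enat T" "T_Delta_col idb n k = enat T'" by auto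
  obtain A where A: "det_correct (idb n) (D + 1) n D (graphs n D) A"
      "det_time (idb n) n D (graphs n D) A \<le> enat T"
    by (rule INF_enat_attained[OF T(1)[THEN eq_refl, unfolded T_Delta_plus_one_col_def det_complexity_def]])
      auto
  obtain B where B: "det_correct (idb n) k n k {G \<in> graphs n k. colorable k n G} B"
      "det_time (idb n) n k {G \<in> graphs n k. colorable k n G} B \<le> enat T'"
    by (rule INF_enat_attained[OF T(2)[THEN eq_refl, unfolded T_Delta_col_def det_complexity_def]])
      auto
  let ?\<Phi> = "\<lambda>G x. two_phase n k D A T B T' G x x"
  let ?\<G> = "{G \<in> graphs n D. clique_free (k + 1) n G}"
  have proper: "proper_coloring D n G (?\<Phi> G x)" if G: "G \<in> ?\<G>" and x: "x \<in> id_assignments (idb n) n" for G x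
  proof -
    have "colors_properly (D + 1) A n D G x" "running_time A n D G x \<le> enat T"
      using A G x unfolding det_correct_def det_time_def by (auto simp: SUP_le_iff)
    then have c: "proper_coloring (D + 1) n G (output_at A n D G x T)"
      using G by (intro colors_properly_output_at) (auto simp: graphs_def)
    let ?H = "uncolored_part G (D - k) (leftover n k D A T G x)"
    have H: "?H \<in> graphs n k" "colorable k n ?H"
      using uncolored_part(1,2)[OF n k _ _ c] G unfolding leftover_def by auto
    then have "colors_properly k B n k ?H x" "running_time B n k ?H x \<le> enat T'"
      using B x unfolding det_correct_def det_time_def by (auto simp: SUP_le_iff)
    then have "proper_coloring k n ?H (output_at B n k ?H x T')"
      using H by (intro colors_properly_output_at) (auto simp: graphs_def)
    then show ?thesis using uncolored_part(3)[OF n k _ _ c] G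
      unfolding leftover_def two_phase_def Let_def by auto
  qed
  obtain M where M: "\<And>D G x. is_graph n G \<Longrightarrow> running_time M n D G x \<le> enat (T + k + T' + 3)"
    "\<And>k D G x. is_graph n G \<Longrightarrow> proper_coloring k n G (?\<Phi> G x) \<Longrightarrow> colors_properly k M n D G x"
    using implement_computable[OF computable_two_phase[where p = "\<lambda>i. i" and q = "\<lambda>i. i"]] by blast
  have "det_complexity (idb n) D n D ?\<G> \<le> det_time (idb n) n D ?\<G> M"
    unfolding det_complexity_def
    by (rule INF_lower) (use M(2) proper in \<open>auto simp: det_correct_def graphs_def\<close>)
  also have "\<dots> \<le> enat (T + k + T' + 3)"
    unfolding det_time_def by (intro SUP_least M(1)) (auto simp: graphs_def)
  \<comment> \<open>The additive 3 is absorbed by \<open>k\<close>.\<close>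
  also have "\<dots> \<le> 2 * (enat T + enat k + enat T')"
    using k by (simp add: numeral_eq_enat)
  finally show ?thesis unfolding T_Delta_col_clique_free_def T .
qed

section \<open>Independence of random bits\<close>

lemma emeasure_pair_pmf:
  "emeasure (measure_pmf (pair_pmf p q)) X = (\<integral>\<^sup>+x. emeasure (measure_pmf q) {y. (x, y) \<in> X} \<partial>measure_pmf p)"
proof -
  have "emeasure (measure_pmf (pair_pmf p q)) X = (\<integral>\<^sup>+z. indicator X z \<partial>measure_pmf (pair_pmf p q))"
    by simp
  also have "\<dots> = (\<integral>\<^sup>+x. \<integral>\<^sup>+y. indicator X (x, y) \<partial>measure_pmf q \<partial>measure_pmf p)"
    by (rule nn_integral_pair_pmf')
  also have "\<dots> = (\<integral>\<^sup>+x. \<integral>\<^sup>+y. indicator {y. (x, y) \<in> X} y \<partial>measure_pmf q \<partial>measure_pmf p)"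
    by (intro nn_integral_cong) (auto simp: indicator_def)
  finally show ?thesis by simp
qed

text \<open>Condition on \<open>x\<close>. The event \<open>Q\<close> may depend on it, as the graph
  of the second phase depends on the bits used in the first.\<close>

lemma prob_pair_pmf_ge:
  assumes "\<And>x. P x \<Longrightarrow> c \<le> measure_pmf.prob q {y. Q x y}" "0 \<le> c"
  shows "c * measure_pmf.prob p {x. P x} \<le> measure_pmf.prob (pair_pmf p q) {(x, y). P x \<and> Q x y}"
proof -
  have "ennreal (c * measure_pmf.prob p {x. P x}) = (\<integral>\<^sup>+x. ennreal c * indicator {x. P x} x \<partial>measure_pmf p)"
    using assms(2) by (simp add: nn_integral_cmult measure_pmf.emeasure_eq_measure ennreal_mult)
  also have "\<dots> \<le> (\<integral>\<^sup>+x. emeasure (measure_pmf q) {y. (x, y) \<in> {(x, y). P x \<and> Q x y}} \<partial>measure_pmf p)"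
    using assms(1) by (intro nn_integral_mono) (auto simp: indicator_def measure_pmf.emeasure_eq_measure intro: ennreal_leI)
  also have "\<dots> = emeasure (measure_pmf (pair_pmf p q)) {(x, y). P x \<and> Q x y}"
    by (rule emeasure_pair_pmf[symmetric])
  also have "\<dots> = ennreal (measure_pmf.prob (pair_pmf p q) {(x, y). P x \<and> Q x y})"
    by (rule measure_pmf.emeasure_eq_measure)
  finally show ?thesis by (simp add: ennreal_le_iff)
qed

lemma prob_pair_pmf_Times:
  "measure_pmf.prob (pair_pmf p q) {(x, y). P x \<and> Q y}
    = measure_pmf.prob p {x. P x} * measure_pmf.prob q {y. Q y}"
proof -
  have "emeasure (measure_pmf (pair_pmf p q)) {(x, y). P x \<and> Q y}
      = (\<integral>\<^sup>+x. emeasure (measure_pmf q) {y. Q y} * indicator {x. P x} x \<partial>measure_pmf p)"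
    unfolding emeasure_pair_pmf by (intro nn_integral_cong) (auto simp: indicator_def)
  also have "\<dots> = emeasure (measure_pmf q) {y. Q y} * emeasure (measure_pmf p) {x. P x}"
    by (rule nn_integral_cmult_indicator) simp
  finally show ?thesis
    unfolding measure_pmf.emeasure_eq_measure by (simp add: ennreal_mult[symmetric] mult.commute)
qed

lemma pair_pmf_of_set:
  assumes "finite A" "A \<noteq> {}" "finite B" "B \<noteq> {}"
  shows "pair_pmf (pmf_of_set A) (pmf_of_set B) = pmf_of_set (A \<times> B)"
proof (rule pmf_eqI)
  fix z show "pmf (pair_pmf (pmf_of_set A) (pmf_of_set B)) z = pmf (pmf_of_set (A \<times> B)) z"
    using assms by (cases z) (auto simp: pmf_pair card_cartesian_product indicator_def)
qed

section \<open>Uniform inputs and disjoint node sets\<close>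

definition inputs :: "nat \<Rightarrow> nat \<Rightarrow> (nat \<Rightarrow> bool list) set" where
  "inputs b n = PiE_dflt {..<n} [] (\<lambda>_. bit_strings b)"

lemma inputs_iff: "x \<in> inputs b n \<longleftrightarrow> (\<forall>v. if v < n then length (x v) = b else x v = [])"
  by (auto simp: inputs_def PiE_dflt_def bit_strings_def)

lemma finite_bit_strings: "finite (bit_strings b)"
  using finite_lists_length_eq[of "UNIV :: bool set" b] by (simp add: bit_strings_def)

lemma finite_inputs: "finite (inputs b n)"
  unfolding inputs_def using finite_bit_strings by (intro finite_PiE_dflt) auto

lemma inputs_nonempty: "inputs b n \<noteq> {}"
proof -
  have "(\<lambda>v. if v < n then replicate b True else []) \<in> inputs b n" by (simp add: inputs_iff)
  then show ?thesis by blast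
qed

lemma random_bits_eq: "random_bits b n = pmf_of_set (inputs b n)"
proof -
  have "bit_strings b \<noteq> {}" using length_replicate[of b True] unfolding bit_strings_def by blast
  then show ?thesis
    unfolding random_bits_def inputs_def using finite_bit_strings by (intro Pi_pmf_of_set) auto
qed

lemma set_random_bits [simp]: "set_pmf (random_bits b n) = inputs b n"
  by (simp add: random_bits_eq finite_inputs inputs_nonempty)

text \<open>Splitting every string at \<open>b\<close> is a bijection, so the two parts are
  independent and uniform.\<close>

lemma split_random_bits:
  "map_pmf (\<lambda>x. (\<lambda>v. take b (x v), \<lambda>v. drop b (x v))) (random_bits (b + b') n)
    = pair_pmf (random_bits b n) (random_bits b' n)"
  unfolding random_bits_eq pair_pmf_of_set[OF finite_inputs inputs_nonempty finite_inputs inputs_nonempty]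
proof (rule map_pmf_of_set_bij_betw)
  show "bij_betw (\<lambda>x. (\<lambda>v. take b (x v), \<lambda>v. drop b (x v))) (inputs (b + b') n) (inputs b n \<times> inputs b' n)"
  proof (rule bij_betw_byWitness[where f' = "\<lambda>(x, y) v. x v @ y v"])
    show "\<forall>z\<in>inputs b n \<times> inputs b' n. (\<lambda>x. (\<lambda>v. take b (x v), \<lambda>v. drop b (x v))) ((\<lambda>(x, y) v. x v @ y v) z) = z"
    proof (intro ballI, clarsimp)
      fix x y assume "x \<in> inputs b n" "y \<in> inputs b' n"
      \<comment> \<open>Beyond \<open>n\<close> both strings are the default \<open>[]\<close>,
        which splits into itself.\<close>
      then have "length (x v) = b \<or> x v = [] \<and> y v = []" for v
        unfolding inputs_iff by meson
      then have "take b (x v @ y v) = x v \<and> drop b (x v @ y v) = y v" for v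
        by (metis append_Nil append_eq_conv_conj drop_Nil take_Nil)
      then show "(\<lambda>v. take b (x v) @ take (b - length (x v)) (y v)) = x \<and>
          (\<lambda>v. drop b (x v) @ drop (b - length (x v)) (y v)) = y"
        by simp
    qed
    show "(\<lambda>x. (\<lambda>v. take b (x v), \<lambda>v. drop b (x v))) ` inputs (b + b') n \<subseteq> inputs b n \<times> inputs b' n"
      unfolding image_subset_iff mem_Times_iff by (simp add: inputs_iff)
    show "(\<lambda>(x, y) v. x v @ y v) ` (inputs b n \<times> inputs b' n) \<subseteq> inputs (b + b') n"
      unfolding inputs_iff image_subset_iff by (auto simp: inputs_iff)
  qed simp
qed (simp_all add: finite_inputs inputs_nonempty)

text \<open>
  Resampling a fixed node set is one half of an exchange of two independent inputs. This yields the
  independence of events on disjoint node sets without splitting the product distribution.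
\<close>

definition exchange :: "'a set \<Rightarrow> ('a \<Rightarrow> 'b) \<times> ('a \<Rightarrow> 'b) \<Rightarrow> ('a \<Rightarrow> 'b) \<times> ('a \<Rightarrow> 'b)" where
  "exchange U = (\<lambda>(x, y). (\<lambda>v. if v \<in> U then x v else y v, \<lambda>v. if v \<in> U then y v else x v))"

lemma exchange_random_bits:
  "map_pmf (exchange U) (pair_pmf (random_bits b n) (random_bits b n))
    = pair_pmf (random_bits b n) (random_bits b n)"
  unfolding random_bits_eq pair_pmf_of_set[OF finite_inputs inputs_nonempty finite_inputs inputs_nonempty]
proof (rule map_pmf_of_set_bij_betw)
  show "bij_betw (exchange U) (inputs b n \<times> inputs b n) (inputs b n \<times> inputs b n)"
    by (rule bij_betw_byWitness[where f' = "exchange U"])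
      (auto simp: exchange_def inputs_iff fun_eq_iff)
qed (simp_all add: finite_inputs inputs_nonempty)

definition depends_only :: "(('a \<Rightarrow> 'b) \<Rightarrow> bool) \<Rightarrow> 'a set \<Rightarrow> bool" where
  "depends_only P U \<longleftrightarrow> (\<forall>x y. (\<forall>v\<in>U. x v = y v) \<longrightarrow> P x = P y)"

lemma depends_onlyD: "depends_only P U \<Longrightarrow> (\<And>v. v \<in> U \<Longrightarrow> x v = y v) \<Longrightarrow> P x = P y"
  unfolding depends_only_def by blast

text \<open>\<open>P\<close> cannot see the exchange, which leaves \<open>x\<close> in place on
  \<open>U\<close>, and the second exchanged component is the resampled input. So the event is the
  preimage of a product event under a map preserving the distribution.\<close>

lemma prob_resample:
  assumes "depends_only P U"
  shows "measure_pmf.prob (pair_pmf (random_bits b n) (random_bits b n))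
      {(x, y). P x \<and> Q (\<lambda>v. if v \<in> U then y v else x v)}
    = measure_pmf.prob (random_bits b n) {x. P x} * measure_pmf.prob (random_bits b n) {x. Q x}"
proof -
  have "P (\<lambda>v. if v \<in> U then x v else y v) = P x" for x y
    by (rule depends_onlyD[OF assms]) simp
  then have "exchange U -` {(x, y). P x \<and> Q y} = {(x, y). P x \<and> Q (\<lambda>v. if v \<in> U then y v else x v)}"
    by (auto simp: exchange_def)
  then have "measure_pmf.prob (pair_pmf (random_bits b n) (random_bits b n))
      {(x, y). P x \<and> Q (\<lambda>v. if v \<in> U then y v else x v)}
    = measure_pmf.prob (map_pmf (exchange U) (pair_pmf (random_bits b n) (random_bits b n))) {(x, y). P x \<and> Q y}"
    by simp
  then show ?thesis unfolding exchange_random_bits prob_pair_pmf_Times .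
qed

text \<open>By \<open>prob_resample\<close>, since resampling \<open>U\<close> does not touch what
  \<open>Q\<close> reads.\<close>

lemma prob_conj_independent:
  assumes "depends_only P U" "depends_only Q W" "U \<inter> W = {}"
  shows "measure_pmf.prob (random_bits b n) {x. P x \<and> Q x}
    = measure_pmf.prob (random_bits b n) {x. P x} * measure_pmf.prob (random_bits b n) {x. Q x}"
proof -
  have "Q (\<lambda>v. if v \<in> U then y v else x v) = Q x" for x y
    using assms(3) by (intro depends_onlyD[OF assms(2)]) auto
  then have "measure_pmf.prob (random_bits b n) {x. P x} * measure_pmf.prob (random_bits b n) {x. Q x}
    = measure_pmf.prob (pair_pmf (random_bits b n) (random_bits b n)) {(x, y). P x \<and> Q x}"
    by (subst prob_resample[OF assms(1), symmetric]) simp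
  also have "\<dots> = measure_pmf.prob (map_pmf fst (pair_pmf (random_bits b n) (random_bits b n))) {x. P x \<and> Q x}"
    by (simp add: vimage_def case_prod_unfold del: measure_map_pmf) (simp add: vimage_def)
  finally show ?thesis by (simp add: map_fst_pair_pmf)
qed

lemma prob_Ball_independent:
  assumes "finite T" "\<And>i. i \<in> T \<Longrightarrow> depends_only (P i) (U i)"
    and "\<And>i j. i \<in> T \<Longrightarrow> j \<in> T \<Longrightarrow> i \<noteq> j \<Longrightarrow> U i \<inter> U j = {}"
  shows "measure_pmf.prob (random_bits b n) {x. \<forall>i\<in>T. P i x}
    = (\<Prod>i\<in>T. measure_pmf.prob (random_bits b n) {x. P i x})"
  using assms
proof (induction T rule: finite_induct)
  case (insert a T)
  have "depends_only (\<lambda>x. \<forall>i\<in>T. P i x) (\<Union>i\<in>T. U i)"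
    unfolding depends_only_def
  proof (intro allI impI ball_cong refl)
    fix x y :: "nat \<Rightarrow> bool list" and i assume "\<forall>v\<in>\<Union>i\<in>T. U i. x v = y v" "i \<in> T"
    then show "P i x = P i y" using insert.prems(1) by (intro depends_onlyD[of "P i" "U i"]) auto
  qed
  moreover have "U a \<inter> U i = {}" if "i \<in> T" for i
    using that insert.hyps(2) by (intro insert.prems(2)) auto
  then have "U a \<inter> (\<Union>i\<in>T. U i) = {}" by blast
  ultimately have "measure_pmf.prob (random_bits b n) {x. P a x \<and> (\<forall>i\<in>T. P i x)}
    = measure_pmf.prob (random_bits b n) {x. P a x} * measure_pmf.prob (random_bits b n) {x. \<forall>i\<in>T. P i x}"
    using insert.prems(1)
    by (intro prob_conj_independent[of "P a" "U a" "\<lambda>x. \<forall>i\<in>T. P i x" "\<Union>i\<in>T. U i"]) auto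
  then show ?case using insert by auto
qed simp

section \<open>Comparing expected counts\<close>

lemma sum_prob_eq_expectation:
  assumes "finite A"
  shows "(\<Sum>a\<in>A. measure_pmf.prob p {x. P a x})
    = measure_pmf.expectation p (\<lambda>x. real (card {a \<in> A. P a x}))"
proof -
  have "(\<Sum>a\<in>A. measure_pmf.prob p {x. P a x})
      = (\<Sum>a\<in>A. measure_pmf.expectation p (indicator {x. P a x}))"
    by simp
  also have "\<dots> = measure_pmf.expectation p (\<lambda>x. \<Sum>a\<in>A. indicator {x. P a x} x)"
    by (rule Bochner_Integration.integral_sum[symmetric])
      (auto intro!: measure_pmf.integrable_const_bound[where B = 1])
  also have "(\<lambda>x. \<Sum>a\<in>A. indicator {x. P a x} x :: real) = (\<lambda>x. real (card {a \<in> A. P a x}))"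
    using assms by (auto simp: indicator_def sum.If_cases Int_def)
  finally show ?thesis .
qed

lemma integrable_card_filter:
  assumes "finite A"
  shows "integrable (measure_pmf p) (\<lambda>x. real (card {a \<in> A. P a x}))"
  using assms by (intro measure_pmf.integrable_const_bound[where B = "real (card A)"])
    (auto intro!: card_mono)

text \<open>Each sum is the expected number of events that occur, so comparing the counts for every
  outcome suffices.\<close>

lemma sum_prob_le_sum_prob:
  assumes "finite A" "finite B" "\<And>x. card {a \<in> A. P a x} \<le> card {b \<in> B. Q b x}"
  shows "(\<Sum>a\<in>A. measure_pmf.prob p {x. P a x}) \<le> (\<Sum>b\<in>B. measure_pmf.prob p {x. Q b x})"
  unfolding sum_prob_eq_expectation[OF assms(1)] sum_prob_eq_expectation[OF assms(2)]
  using assms by (intro integral_mono integrable_card_filter) auto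

section \<open>Resampling near failures\<close>

text \<open>Greedy choice: an element is added only if unrelated to those already chosen. This
  provides both the net of cell centers and the far-apart families of failing cells.\<close>

lemma maximal_separated_subset:
  assumes "finite A" "\<And>a. R a a" "\<And>a b. a \<in> A \<Longrightarrow> b \<in> A \<Longrightarrow> R a b \<Longrightarrow> R b a"
  shows "\<exists>T\<subseteq>A. (\<forall>a\<in>T. \<forall>b\<in>T. a \<noteq> b \<longrightarrow> \<not> R a b) \<and> (\<forall>a\<in>A. \<exists>b\<in>T. R a b)"
  using assms(1,3)
proof (induction A rule: finite_induct)
  case (insert c A)
  then obtain T where T: "T \<subseteq> A" "\<forall>a\<in>T. \<forall>b\<in>T. a \<noteq> b \<longrightarrow> \<not> R a b" "\<forall>a\<in>A. \<exists>b\<in>T. R a b"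
    by (metis insertCI)
  show ?case
  proof (cases "\<exists>b\<in>T. R c b")
    case True
    then show ?thesis using T by (intro exI[of _ T]) auto
  next
    case False
    moreover have "\<not> R b c" if "b \<in> T" for b
      using that False insert.prems[of b c] T(1) by auto
    ultimately show ?thesis using T assms(2) by (intro exI[of _ "insert c T"]) auto
  qed
qed simp

definition resample_near ::
  "port_graph \<Rightarrow> ((nat \<Rightarrow> 'a) \<Rightarrow> nat \<Rightarrow> bool) \<Rightarrow> nat \<Rightarrow> (nat \<Rightarrow> 'a) \<Rightarrow> (nat \<Rightarrow> 'a) \<Rightarrow> nat \<Rightarrow> 'a" where
  "resample_near G bad \<rho> x y v = (if \<exists>u. reach G \<rho> v u \<and> bad x u then y v else x v)"

locale local_failure =
  fixes n :: nat and G :: port_graph and \<tau> :: nat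
    and bad :: "(nat \<Rightarrow> bool list) \<Rightarrow> nat \<Rightarrow> bool"
  assumes graph: "is_graph n G"
    and locality: "v < n \<Longrightarrow> (\<And>u. reach G \<tau> v u \<Longrightarrow> x u = y u) \<Longrightarrow> bad x v = bad y v"
begin

lemma sym_reach: "u < n \<Longrightarrow> reach G r u v \<Longrightarrow> reach G r v u"
  by (rule reach_sym[OF graph])

lemma less_reach: "u < n \<Longrightarrow> reach G r u v \<Longrightarrow> v < n"
  by (rule reach_less[OF graph])

abbreviation resample :: "nat \<Rightarrow> (nat \<Rightarrow> bool list) \<Rightarrow> (nat \<Rightarrow> bool list) \<Rightarrow> nat \<Rightarrow> bool list" where
  "resample \<equiv> resample_near G bad"

definition failure_prob :: "nat \<Rightarrow> real" where
  "failure_prob b = measure_pmf.prob (random_bits b n) {x. \<exists>v<n. bad x v}"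

text \<open>Requiring \<open>F\<close> to be the whole failure set would involve the input
  everywhere. This weaker condition reads it only near \<open>F\<close>, and the whole failure set
  satisfies it.\<close>

definition isolates :: "nat \<Rightarrow> nat set \<Rightarrow> (nat \<Rightarrow> bool list) \<Rightarrow> bool" where
  "isolates s F x \<longleftrightarrow> (\<forall>v\<in>F. bad x v) \<and> (\<forall>v<n. bad x v \<longrightarrow> (\<exists>u\<in>F. reach G s v u) \<longrightarrow> v \<in> F)"

text \<open>A node within distance \<open>s\<close> of \<open>F\<close> is checked on its
  \<open>\<tau>\<close>-ball, which gives the radius \<open>s + \<tau>\<close>. Resampling uses the
  same radius.\<close>

lemma depends_only_isolates:
  assumes "F \<subseteq> {..<n}"
  shows "depends_only (isolates s F) {w. \<exists>u\<in>F. reach G (s + \<tau>) w u}"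
  unfolding depends_only_def
proof (intro allI impI)
  fix x y :: "nat \<Rightarrow> bool list" assume eq: "\<forall>w\<in>{w. \<exists>u\<in>F. reach G (s + \<tau>) w u}. x w = y w"
  have same: "bad x v = bad y v" if v: "v < n" "u \<in> F" "reach G s v u" for u v
  proof (rule locality[OF v(1)])
    fix w assume "reach G \<tau> v w"
    then have "reach G (\<tau> + s) w u" using reach_trans[OF sym_reach[OF v(1)] v(3)] by blast
    then show "x w = y w" using eq v(2) by (auto simp: add.commute)
  qed
  have "bad x v = bad y v" if "v \<in> F" for v
    using same[of v v] that assms by auto
  then show "isolates s F x = isolates s F y" unfolding isolates_def using same by blast
qed

text \<open>
  The failure set \<open>F\<close> of the first input is isolated, and being isolated is decided by the first input on the
  resampled nodes only. The input after resampling is therefore fresh, and fails with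
  probability \<open>failure_prob\<close> independently of that event.
\<close>

lemma resample_failure_le_sum:
  "measure_pmf.prob (pair_pmf (random_bits b n) (random_bits b n))
      {(x, y). \<exists>v<n. bad (resample (s + \<tau>) x y) v}
    \<le> (\<Sum>F\<in>Pow {..<n} - {{}}. measure_pmf.prob (random_bits b n) {x. isolates s F x}) * failure_prob b"
proof -
  let ?\<mu> = "pair_pmf (random_bits b n) (random_bits b n)"
  let ?U = "\<lambda>F. {w. \<exists>u\<in>F. reach G (s + \<tau>) w u}"
  let ?E = "\<lambda>F. {(x, y). isolates s F x \<and> (\<exists>v<n. bad (\<lambda>w. if w \<in> ?U F then y w else x w) v)}"
  have sub: "{(x, y). \<exists>v<n. bad (resample (s + \<tau>) x y) v} \<subseteq> (\<Union>F\<in>Pow {..<n} - {{}}. ?E F)"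
  proof clarify
    fix x y v assume v: "v < n" "bad (resample (s + \<tau>) x y) v"
    define F where "F = {v. v < n \<and> bad x v}"
    \<comment> \<open>For the actual failure set \<open>F\<close>, resampling near failures amounts
      to resampling the fixed set \<open>?U F\<close>.\<close>
    have "resample (s + \<tau>) x y w = (if w \<in> ?U F then y w else x w)" if "w < n" for w
      using less_reach[OF that] by (auto simp: resample_near_def F_def)
    then have "bad (resample (s + \<tau>) x y) v = bad (\<lambda>w. if w \<in> ?U F then y w else x w) v"
      using less_reach[OF v(1)] by (intro locality v(1)) blast
    \<comment> \<open>Without failures nothing would be resampled, and the second run would repeat
      the success.\<close>
    moreover have "F \<noteq> {}"
    proof
      assume "F = {}"
      then have "resample (s + \<tau>) x y w = x w" if "w < n" for w
        using less_reach[OF that] by (auto simp: resample_near_def F_def)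
      then have "bad (resample (s + \<tau>) x y) v = bad x v" using less_reach[OF v(1)] by (intro locality v(1)) blast
      then show False using v \<open>F = {}\<close> by (auto simp: F_def)
    qed
    moreover have "isolates s F x" by (auto simp: isolates_def F_def)
    ultimately show "(x, y) \<in> (\<Union>F\<in>Pow {..<n} - {{}}. ?E F)"
      using v by (intro UN_I[of F]) (auto simp: F_def)
  qed
  have "measure_pmf.prob ?\<mu> {(x, y). \<exists>v<n. bad (resample (s + \<tau>) x y) v}
      \<le> measure_pmf.prob ?\<mu> (\<Union>F\<in>Pow {..<n} - {{}}. ?E F)"
    by (rule measure_pmf.finite_measure_mono[OF sub]) simp
  also have "\<dots> \<le> (\<Sum>F\<in>Pow {..<n} - {{}}. measure_pmf.prob ?\<mu> (?E F))"
    by (rule measure_pmf.finite_measure_subadditive_finite) auto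
  also have "\<dots> = (\<Sum>F\<in>Pow {..<n} - {{}}. measure_pmf.prob (random_bits b n) {x. isolates s F x} * failure_prob b)"
    unfolding failure_prob_def
    by (intro sum.cong refl prob_resample[OF depends_only_isolates]) auto
  finally show ?thesis by (simp add: sum_distrib_right)
qed

text \<open>
  A ball with at most as many nodes as its radius is a whole connected component.
\<close>

lemma ball_saturated:
  assumes z: "z < n" and card: "card {v. reach G a z v} \<le> a" and reach: "reach G r z v"
  shows "reach G a z v"
proof -
  define B where "B r = {v. reach G r z v}" for r
  have fin: "finite (B r)" for r
    unfolding B_def by (rule finite_subset[of _ "{..<n}"]) (auto dest: less_reach[OF z])
  have mono: "B r \<subseteq> B r'" if "r \<le> r'" for r r'
    unfolding B_def by (intro Collect_mono impI reach_mono[OF _ that])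
  have step: "B (Suc i) = B i \<union> (\<Union>u\<in>B i. set (G u))" for i
    unfolding B_def by (auto simp: reach_Suc_right simp del: reach.simps)
  \<comment> \<open>While balls grow, each step adds a node, so \<open>a\<close> growing steps would
    give more than \<open>a\<close> nodes.\<close>
  have "\<exists>i<a. B (Suc i) = B i"
  proof (rule ccontr)
    assume no: "\<not> (\<exists>i<a. B (Suc i) = B i)"
    have "i \<le> a \<Longrightarrow> i < card (B i)" for i
    proof (induction i)
      case 0
      have "B 0 = {z}" by (auto simp: B_def)
      then show ?case by simp
    next
      case (Suc i)
      have "B (Suc i) \<noteq> B i" using no Suc_le_lessD[OF Suc.prems] by blast
      then have "B i \<subset> B (Suc i)" using mono[of i "Suc i"] by (intro psubsetI) auto
      then have "card (B i) < card (B (Suc i))" by (rule psubset_card_mono[OF fin])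
      then show ?case using Suc by simp
    qed
    from this[of a] show False using card by (simp add: B_def)
  qed
  then obtain i where i: "i < a" "B (Suc i) = B i" by blast
  have "B (i + j) = B i" for j
  proof (induction j)
    case (Suc j)
    then show ?case using step[of "i + j"] step[of i] i(2) by simp
  qed simp
  from this[of "r - i"] have "B (max i r) = B i" by (cases "i \<le> r") (simp_all add: max_def)
  then have "B r \<subseteq> B a" using mono[of r "max i r"] mono[of i a] i(1) by simp
  then show ?thesis using reach by (auto simp: B_def)
qed

text \<open>
  A failure set isolated at distance \<open>s\<close> is determined by the failing cells of a maximal
  far-apart family of its net points, so such sets are at most as numerous as such families.
\<close>

lemma sum_isolates_le:
  fixes a b :: nat
  assumes Z: "Z \<subseteq> {..<n}" and cell: "\<And>v. v < n \<Longrightarrow> cell v \<in> Z \<and> reach G (2 * a) v (cell v)"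
  defines "h \<equiv> 4 * a + 2 * \<tau>" and "p \<equiv> \<lambda>z. measure_pmf.prob (random_bits b n) {x. \<exists>v<n. cell v = z \<and> bad x v}"
  shows "(\<Sum>F\<in>Pow {..<n} - {{}}. measure_pmf.prob (random_bits b n) {x. isolates (h + 4 * a) F x})
    \<le> (\<Prod>z\<in>Z. 1 + p z) - 1"
proof -
  \<comment> \<open>Cells with centers more than \<open>h\<close> apart read disjoint inputs: a
    common node would give a walk of two legs \<open>2 * a\<close> and two legs
    \<open>\<tau>\<close>. The extra \<open>4 * a\<close> leads from two centers back to failing
    nodes, so \<open>F\<close> contains all failures in cells near \<open>T\<close>.\<close>
  let ?s = "h + 4 * a"
  have finZ: "finite Z" using Z finite_subset by blast
  define far where "far T \<longleftrightarrow> (\<forall>z\<in>T. \<forall>z'\<in>T. z \<noteq> z' \<longrightarrow> \<not> reach G h z z')" for T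
  define fails where "fails z x \<longleftrightarrow> (\<exists>v<n. cell v = z \<and> bad x v)" for z x
  define \<T> where "\<T> = {T \<in> Pow Z - {{}}. far T}"
  have fin: "finite \<T>" using finZ by (auto simp: \<T>_def)
  have "card {F \<in> Pow {..<n} - {{}}. isolates ?s F x} \<le> card {T \<in> \<T>. \<forall>z\<in>T. fails z x}" for x
  proof (rule surj_card_le)
    show "finite {T \<in> \<T>. \<forall>z\<in>T. fails z x}" using fin by simp
    \<comment> \<open>\<open>?g\<close> recovers \<open>F\<close> from \<open>T\<close>, so it
      suffices to count the families \<open>T\<close>.\<close>
    let ?g = "\<lambda>T. {v. v < n \<and> bad x v \<and> (\<exists>z\<in>T. reach G h (cell v) z)}"
    show "{F \<in> Pow {..<n} - {{}}. isolates ?s F x} \<subseteq> ?g ` {T \<in> \<T>. \<forall>z\<in>T. fails z x}"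
    proof
      fix F assume "F \<in> {F \<in> Pow {..<n} - {{}}. isolates ?s F x}"
      then have F: "F \<subseteq> {..<n}" "F \<noteq> {}" "\<And>v. v \<in> F \<Longrightarrow> bad x v"
        and closed: "\<And>v u. v < n \<Longrightarrow> bad x v \<Longrightarrow> u \<in> F \<Longrightarrow> reach G ?s v u \<Longrightarrow> v \<in> F"
        by (auto simp: isolates_def)
      have cF: "cell ` F \<subseteq> Z" using cell F(1) by auto
      have "\<exists>T\<subseteq>cell ` F. (\<forall>z\<in>T. \<forall>z'\<in>T. z \<noteq> z' \<longrightarrow> \<not> reach G h z z') \<and>
          (\<forall>z\<in>cell ` F. \<exists>z'\<in>T. reach G h z z')"
      proof (rule maximal_separated_subset)
        show "finite (cell ` F)" using finite_subset[OF F(1)] by simp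
        show "reach G h z' z" if "z \<in> cell ` F" "reach G h z z'" for z z'
          using that cF Z by (intro sym_reach[of z]) auto
      qed simp
      then obtain T where T': "T \<subseteq> cell ` F" "\<forall>z\<in>T. \<forall>z'\<in>T. z \<noteq> z' \<longrightarrow> \<not> reach G h z z'"
          "\<forall>z\<in>cell ` F. \<exists>z'\<in>T. reach G h z z'"
        by (elim exE conjE) (rule that)
      have T: "T \<subseteq> cell ` F" "far T" "\<And>v. v \<in> F \<Longrightarrow> \<exists>z\<in>T. reach G h (cell v) z"
        using T' by (simp_all add: far_def)
      have "T \<noteq> {}" using T(3) F(2) by blast
      moreover have "fails z x" if "z \<in> T" for z
        using that T(1) F(1,3) unfolding fails_def by blast
      moreover have "F = ?g T"
      proof
        show "F \<subseteq> ?g T" using F T(3) by auto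
        show "?g T \<subseteq> F"
        proof
          fix v assume "v \<in> ?g T"
          then obtain z where v: "v < n" "bad x v" "z \<in> T" "reach G h (cell v) z" by blast
          then obtain u where u: "u \<in> F" "z = cell u" "u < n" using T(1) F(1) by blast
          have "reach G (2 * a) v (cell v)" "reach G (2 * a) z u"
            using cell[OF v(1)] cell[OF u(3)] sym_reach[OF u(3)] u(2) by auto
          then have "reach G (2 * a + h + 2 * a) v u" using reach_trans v(4) by blast
          then show "v \<in> F" using closed[OF v(1,2) u(1)] by (simp add: algebra_simps)
        qed
      qed
      ultimately show "F \<in> ?g ` {T \<in> \<T>. \<forall>z\<in>T. fails z x}"
        using T(1,2) cF by (intro image_eqI[of _ _ T]) (auto simp: \<T>_def)
    qed
  qed
  then have "(\<Sum>F\<in>Pow {..<n} - {{}}. measure_pmf.prob (random_bits b n) {x. isolates ?s F x})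
      \<le> (\<Sum>T\<in>\<T>. measure_pmf.prob (random_bits b n) {x. \<forall>z\<in>T. fails z x})"
    by (intro sum_prob_le_sum_prob fin) auto
  also have "\<dots> = (\<Sum>T\<in>\<T>. \<Prod>z\<in>T. p z)"
  proof (rule sum.cong[OF refl])
    fix T assume T: "T \<in> \<T>"
    let ?W = "\<lambda>z. {w. \<exists>v<n. cell v = z \<and> reach G \<tau> v w}"
    have "measure_pmf.prob (random_bits b n) {x. \<forall>z\<in>T. fails z x}
        = (\<Prod>z\<in>T. measure_pmf.prob (random_bits b n) {x. fails z x})"
    proof (rule prob_Ball_independent)
      show "finite T" using T finZ finite_subset by (auto simp: \<T>_def)
      show "depends_only (fails z) (?W z)" for z
        unfolding depends_only_def fails_def
      proof (intro allI impI ex_cong1 conj_cong refl)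
        fix x y :: "nat \<Rightarrow> bool list" and v
        assume "\<forall>w\<in>?W z. x w = y w" "v < n" "cell v = z"
        then show "bad x v = bad y v" by (intro locality) auto
      qed
      show "?W z \<inter> ?W z' = {}" if zz: "z \<in> T" "z' \<in> T" "z \<noteq> z'" for z z'
      proof (rule ccontr)
        assume "?W z \<inter> ?W z' \<noteq> {}"
        then obtain w v v' where v: "v < n" "cell v = z" "reach G \<tau> v w"
          "v' < n" "cell v' = z'" "reach G \<tau> v' w" by blast
        have "reach G (2 * a) z v" "reach G \<tau> w v'" "reach G (2 * a) v' z'"
          using cell[OF v(1)] cell[OF v(4)] sym_reach[OF v(1), of "2 * a" z] sym_reach[OF v(4,6)] v(2,5) by auto
        then have "reach G (2 * a + \<tau> + (\<tau> + 2 * a)) z z'"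
          using reach_trans v(3) by blast
        then have "reach G h z z'" by (rule reach_mono) (simp add: h_def)
        then show False using T zz by (auto simp: \<T>_def far_def)
      qed
    qed
    then show "measure_pmf.prob (random_bits b n) {x. \<forall>z\<in>T. fails z x} = (\<Prod>z\<in>T. p z)"
      by (simp add: p_def fails_def)
  qed
  \<comment> \<open>Dropping the far-apart condition leaves the expanded product without the term of
    the empty set.\<close>
  also have "\<dots> \<le> (\<Sum>T\<in>Pow Z - {{}}. \<Prod>z\<in>T. p z)"
    using finZ by (intro sum_mono2) (auto simp: \<T>_def p_def intro!: prod_nonneg)
  also have "\<dots> = (\<Sum>T\<in>Pow Z. \<Prod>z\<in>T. p z) - 1"
    using finZ by (subst sum_diff1) auto
  also have "(\<Sum>T\<in>Pow Z. \<Prod>z\<in>T. p z) = (\<Prod>z\<in>Z. p z + 1)"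
    using prod_add[OF finZ, of p "\<lambda>_. 1"] by simp
  finally show ?thesis by (simp add: add.commute)
qed

text \<open>
  Cells centered in components that fit into a ball are independent of each other, so their factors are
  controlled by the overall failure probability; every other cell has at least \<open>a + 1\<close> nodes of its own.
\<close>

lemma prod_cell_failures_le:
  fixes a b :: nat
  assumes Z: "Z \<subseteq> {..<n}" and cell: "\<And>v. v < n \<Longrightarrow> cell v \<in> Z \<and> reach G (2 * a) v (cell v)"
    and sep: "\<And>z z'. z \<in> Z \<Longrightarrow> z' \<in> Z \<Longrightarrow> z \<noteq> z' \<Longrightarrow> \<not> reach G (2 * a) z z'"
    and q: "failure_prob b < 1"
  defines "p \<equiv> \<lambda>z. measure_pmf.prob (random_bits b n) {x. \<exists>v<n. cell v = z \<and> bad x v}"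
  shows "(\<Prod>z\<in>Z. 1 + p z) \<le> exp (failure_prob b * (n / (a + 1))) / (1 - failure_prob b)"
proof -
  let ?q = "failure_prob b"
  let ?pr = "measure_pmf.prob (random_bits b n)"
  define small where "small = {z \<in> Z. card {v. reach G a z v} \<le> a}"
  have finZ: "finite Z" using Z by (rule finite_subset) simp
  then have fins: "finite small" by (simp add: small_def)
  have q0: "0 \<le> ?q" by (simp add: failure_prob_def)
  have p: "0 \<le> p z" "p z \<le> ?q" for z
    by (auto simp: p_def failure_prob_def intro!: measure_pmf.finite_measure_mono)
  \<comment> \<open>Overall success entails success in all small cells, so independence yields
    \<open>1 - ?q \<le> (\<Prod>z\<in>small. 1 - p z)\<close>. Multiplying by the factors
    \<open>1 + p z\<close> and using \<open>1 - (p z)\<^sup>2 \<le> 1\<close> turns this into an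
    upper bound on their product.\<close>
  have "1 - ?q = ?pr (- {x. \<exists>v<n. bad x v})"
    unfolding failure_prob_def by (subst measure_pmf.prob_compl[symmetric]) (auto simp: Compl_eq_Diff_UNIV)
  also have "\<dots> \<le> ?pr {x. \<forall>z\<in>small. \<not> (\<exists>v<n. cell v = z \<and> bad x v)}"
    by (intro measure_pmf.finite_measure_mono) auto
  also have "\<dots> = (\<Prod>z\<in>small. ?pr {x. \<not> (\<exists>v<n. cell v = z \<and> bad x v)})"
  proof (rule prob_Ball_independent[OF fins])
    let ?W = "\<lambda>z. {w. \<exists>v<n. cell v = z \<and> reach G \<tau> v w}"
    show "depends_only (\<lambda>x. \<not> (\<exists>v<n. cell v = z \<and> bad x v)) (?W z)" for z
      unfolding depends_only_def
    proof (intro allI impI arg_cong[of _ _ Not] ex_cong1 conj_cong refl)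
      fix x y :: "nat \<Rightarrow> bool list" and v
      assume "\<forall>w\<in>?W z. x w = y w" "v < n" "cell v = z"
      then show "bad x v = bad y v" by (intro locality) auto
    qed
    show "?W z \<inter> ?W z' = {}" if zz: "z \<in> small" "z' \<in> small" "z \<noteq> z'" for z z'
    proof (rule ccontr)
      \<comment> \<open>The \<open>a\<close>-ball of a small center is its component, so everything
        its cell reads lies within \<open>a\<close>, however large \<open>\<tau>\<close> is.\<close>
      have near: "reach G a z w" if "z \<in> small" "w \<in> ?W z" for z w
      proof -
        have z: "z < n" "card {v. reach G a z v} \<le> a" using that(1) Z by (auto simp: small_def)
        from that(2) obtain v where v: "v < n" "cell v = z" "reach G \<tau> v w" by auto
        have "reach G (2 * a) z v" using cell[OF v(1)] sym_reach[OF v(1)] v(2) by auto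
        then have "reach G (2 * a + \<tau>) z w" using reach_trans v(3) by blast
        then show ?thesis by (rule ball_saturated[OF z])
      qed
      assume "?W z \<inter> ?W z' \<noteq> {}"
      then obtain w where "w \<in> ?W z" "w \<in> ?W z'" by blast
      then have "reach G a z w" "reach G a z' w" using near zz by blast+
      then have "reach G (a + a) z z'" using zz Z by (intro reach_trans[OF _ sym_reach]) (auto simp: small_def)
      then show False using sep zz by (auto simp: small_def mult_2)
    qed
  qed
  also have "\<dots> = (\<Prod>z\<in>small. 1 - p z)"
  proof (rule prod.cong[OF refl])
    fix z
    have "{x. \<not> (\<exists>v<n. cell v = z \<and> bad x v)} = - {x. \<exists>v<n. cell v = z \<and> bad x v}" by auto
    then show "?pr {x. \<not> (\<exists>v<n. cell v = z \<and> bad x v)} = 1 - p z"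
      unfolding p_def by (subst measure_pmf.prob_compl[symmetric]) (auto simp: Compl_eq_Diff_UNIV)
  qed
  finally have "(\<Prod>z\<in>small. 1 + p z) * (1 - ?q) \<le> (\<Prod>z\<in>small. 1 + p z) * (\<Prod>z\<in>small. 1 - p z)"
    using p by (intro mult_left_mono prod_nonneg) (auto intro: add_nonneg_nonneg)
  also have "\<dots> = (\<Prod>z\<in>small. 1 - (p z)\<^sup>2)"
    unfolding prod.distrib[symmetric] by (simp add: power2_eq_square algebra_simps)
  also have "\<dots> \<le> 1"
  proof (rule prod_le_1)
    fix z
    have "(p z)\<^sup>2 \<le> 1" using p[of z] q by (intro power_le_one) auto
    then show "0 \<le> 1 - (p z)\<^sup>2 \<and> 1 - (p z)\<^sup>2 \<le> 1" by simp
  qed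
  finally have s: "(\<Prod>z\<in>small. 1 + p z) \<le> 1 / (1 - ?q)" using q by (simp add: pos_le_divide_eq)
  \<comment> \<open>The \<open>a\<close>-balls of centers are disjoint and the large ones have at
    least \<open>a + 1\<close> nodes, so there are at most \<open>n / (a + 1)\<close> large
    ones.\<close>
  have "card (\<Union>z\<in>Z - small. {v. reach G a z v}) = (\<Sum>z\<in>Z - small. card {v. reach G a z v})"
  proof (rule card_UN_disjoint)
    show "\<forall>z\<in>Z - small. finite {v. reach G a z v}"
      using Z less_reach finite_subset[of _ "{..<n}"] by (metis (no_types, lifting) DiffD1 finite_lessThan lessThan_iff mem_Collect_eq subset_iff)
    show "\<forall>z\<in>Z - small. \<forall>z'\<in>Z - small. z \<noteq> z' \<longrightarrow> {v. reach G a z v} \<inter> {v. reach G a z' v} = {}"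
    proof (intro ballI impI, rule ccontr)
      fix z z' assume zz: "z \<in> Z - small" "z' \<in> Z - small" "z \<noteq> z'"
        and "{v. reach G a z v} \<inter> {v. reach G a z' v} \<noteq> {}"
      then obtain w where "reach G a z w" "reach G a z' w" by blast
      then have "reach G (a + a) z z'" using zz Z by (intro reach_trans[OF _ sym_reach]) auto
      then show False using sep zz by (auto simp: mult_2)
    qed
  qed (use finZ fins in simp)
  moreover have "card (\<Union>z\<in>Z - small. {v. reach G a z v}) \<le> card {..<n}"
    using Z less_reach by (intro card_mono) auto
  moreover have "(\<Sum>z\<in>Z - small. card {v. reach G a z v}) \<ge> (\<Sum>z\<in>Z - small. a + 1)"
    by (intro sum_mono) (auto simp: small_def)
  ultimately have "card (Z - small) * (a + 1) \<le> n" by simp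
  then have "real (card (Z - small)) * (a + 1) \<le> n" by (metis of_nat_le_iff of_nat_mult)
  then have c: "real (card (Z - small)) \<le> n / (a + 1)" by (simp add: pos_le_divide_eq)
  have "(\<Prod>z\<in>Z - small. 1 + p z) \<le> (\<Prod>z\<in>Z - small. exp ?q)"
  proof (rule prod_mono)
    fix z
    show "0 \<le> 1 + p z \<and> 1 + p z \<le> exp ?q"
      using p[of z] exp_ge_add_one_self[of ?q] by linarith
  qed
  also have "\<dots> = exp (?q * card (Z - small))" by (simp add: exp_of_nat_mult[symmetric] mult.commute)
  also have "\<dots> \<le> exp (?q * (n / (a + 1)))"
    unfolding exp_le_cancel_iff by (rule mult_left_mono[OF c q0])
  finally have l: "(\<Prod>z\<in>Z - small. 1 + p z) \<le> exp (?q * (n / (a + 1)))" .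
  have "(\<Prod>z\<in>Z. 1 + p z) = (\<Prod>z\<in>Z - small. 1 + p z) * (\<Prod>z\<in>small. 1 + p z)"
    by (rule prod.subset_diff) (use finZ in \<open>auto simp: small_def\<close>)
  also have "\<dots> \<le> exp (?q * (n / (a + 1))) * (1 / (1 - ?q))"
    using p by (intro mult_mono l s prod_nonneg) (auto intro: add_nonneg_nonneg)
  finally show ?thesis by simp
qed

text \<open>With \<open>a = 9\<close>, the large cells contribute at most
  \<open>exp (1 / 5) \<le> 5 / 4\<close> and the small ones at most \<open>20 / 19\<close>. The
  product minus 1 is thus at most \<open>1 / 2\<close>, which halves \<open>2 / n\<close>. The
  radius is \<open>h + 4 * a + \<tau>\<close> for this \<open>a\<close>.\<close>

lemma resample_failure_large:
  assumes n: "40 \<le> n" and q: "failure_prob b \<le> 2 / n"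
  shows "measure_pmf.prob (pair_pmf (random_bits b n) (random_bits b n))
      {(x, y). \<exists>v<n. bad (resample (72 + 3 * \<tau>) x y) v} \<le> 1 / n"
proof -
  let ?q = "failure_prob b"
  have q0: "0 \<le> ?q" by (simp add: failure_prob_def)
  have "2 / real n \<le> 2 / 40" using n by (intro divide_left_mono) auto
  then have q1: "?q \<le> 1 / 20" using q by linarith
  have "\<exists>Z\<subseteq>{..<n}. (\<forall>z\<in>Z. \<forall>z'\<in>Z. z \<noteq> z' \<longrightarrow> \<not> reach G (2 * 9) z z') \<and>
      (\<forall>v\<in>{..<n}. \<exists>z\<in>Z. reach G (2 * 9) v z)"
  proof (rule maximal_separated_subset)
    show "reach G (2 * 9) z' z" if "z \<in> {..<n}" "reach G (2 * 9) z z'" for z z'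
      using that by (intro sym_reach[of z]) auto
  qed (simp_all del: reach.simps mult_numeral_left_semiring_numeral)
  then obtain Z where Z: "Z \<subseteq> {..<n}" "\<forall>z\<in>Z. \<forall>z'\<in>Z. z \<noteq> z' \<longrightarrow> \<not> reach G (2 * 9) z z'"
    "\<forall>v\<in>{..<n}. \<exists>z\<in>Z. reach G (2 * 9) v z"
    by (elim exE conjE) (rule that)
  have "\<forall>v. \<exists>z. v < n \<longrightarrow> z \<in> Z \<and> reach G (2 * 9) v z" using Z(3) by blast
  then obtain cell where cell: "\<And>v. v < n \<Longrightarrow> cell v \<in> Z \<and> reach G (2 * 9) v (cell v)"
    using choice[of "\<lambda>v z. v < n \<longrightarrow> z \<in> Z \<and> reach G (2 * 9) v z"] by blast
  let ?p = "\<lambda>z. measure_pmf.prob (random_bits b n) {x. \<exists>v<n. cell v = z \<and> bad x v}"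
  have "?q * (n / (9 + 1)) \<le> 2 / n * (n / 10)" using q by (intro mult_mono) auto
  also have "\<dots> = 1 / 5" using n by simp
  finally have "exp (?q * (n / (9 + 1))) \<le> exp (1 / 5)" by simp
  also have "exp (1 / 5 :: real) \<le> 5 / 4"
  proof -
    have "4 / 5 \<le> exp (- (1 / 5) :: real)" using exp_ge_add_one_self[of "- (1 / 5) :: real"] by simp
    then show ?thesis by (simp add: exp_minus field_simps)
  qed
  finally have "exp (?q * (n / (9 + 1))) / (1 - ?q) \<le> (5 / 4) / (19 / 20)"
    using q1 by (intro frac_le) auto
  moreover have "(\<Prod>z\<in>Z. 1 + ?p z) \<le> exp (?q * (n / (9 + 1))) / (1 - ?q)"
    using prod_cell_failures_le[OF Z(1) cell, of b] Z(2) q1 by auto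
  ultimately have "(\<Prod>z\<in>Z. 1 + ?p z) \<le> (5 / 4) / (19 / 20)" by (rule order_trans[rotated])
  then have prod: "(\<Prod>z\<in>Z. 1 + ?p z) - 1 \<le> 1 / 2" by simp
  have \<rho>: "4 * 9 + 2 * \<tau> + 4 * 9 + \<tau> = 72 + 3 * \<tau>" by simp
  have "measure_pmf.prob (pair_pmf (random_bits b n) (random_bits b n))
      {(x, y). \<exists>v<n. bad (resample (72 + 3 * \<tau>) x y) v}
    \<le> (\<Sum>F\<in>Pow {..<n} - {{}}. measure_pmf.prob (random_bits b n) {x. isolates (4 * 9 + 2 * \<tau> + 4 * 9) F x}) * ?q"
    using resample_failure_le_sum[of b "4 * 9 + 2 * \<tau> + 4 * 9", unfolded \<rho>] .
  also have "\<dots> \<le> 1 / 2 * ?q"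
    using sum_isolates_le[OF Z(1) cell, of b] prod q0 by (intro mult_right_mono) linarith+
  also have "\<dots> \<le> 1 / n" using q by simp
  finally show ?thesis .
qed

text \<open>As \<open>n \<le> \<rho>\<close>, a failure anywhere in a component resamples all of it,
  so failing again requires two independent inputs to fail there.\<close>

lemma resample_failure_component:
  assumes v: "v < n" and n: "n \<le> \<rho>"
    and Q: "measure_pmf.prob (random_bits b n) {x. \<exists>u. reach G n v u \<and> bad x u} \<le> Q"
  shows "measure_pmf.prob (pair_pmf (random_bits b n) (random_bits b n))
      {(x, y). \<exists>u. reach G n v u \<and> bad (resample \<rho> x y) u} \<le> Q\<^sup>2"
proof -
  let ?C = "\<lambda>x. \<exists>u. reach G n v u \<and> bad x u"
  have sat: "reach G n w u" if "w < n" "reach G r w u" for w u r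
  proof (rule ball_saturated[OF that(1) _ that(2)])
    have "card {u. reach G n w u} \<le> card {..<n}" using less_reach[OF that(1)] by (intro card_mono) auto
    then show "card {u. reach G n w u} \<le> n" by simp
  qed
  have both: "?C x \<and> ?C y" if C: "?C (resample \<rho> x y)" for x y
  proof -
    obtain u where u: "reach G n v u" "bad (resample \<rho> x y) u" using C by blast
    then have un: "u < n" using less_reach v by blast
    have comp: "reach G n v w \<longleftrightarrow> reach G n u' w" if "reach G n v u'" for u' w
      using that less_reach[OF v] sat v sym_reach[OF v that] reach_trans by meson
    have same: "(\<exists>w. reach G \<rho> u' w \<and> bad x w) \<longleftrightarrow> ?C x" if "reach G n v u'" for u'
      using comp[OF that] sat reach_mono n less_reach[OF v that] by meson
    have on: "resample \<rho> x y w = (if ?C x then y w else x w)" if "reach G \<tau> u w" for w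
      using same[of w] sat[OF v reach_trans[OF u(1) that]] by (simp add: resample_near_def)
    have "bad (resample \<rho> x y) u = bad (if ?C x then y else x) u"
      using on by (intro locality un) auto
    then show ?thesis using u by (auto split: if_splits)
  qed
  have "{(x, y). ?C (resample \<rho> x y)} \<subseteq> {(x, y). ?C x \<and> ?C y}"
  proof
    fix z assume "z \<in> {(x, y). ?C (resample \<rho> x y)}"
    then have "?C (resample \<rho> (fst z) (snd z))" by (simp only: case_prod_unfold mem_Collect_eq)
    from both[OF this] show "z \<in> {(x, y). ?C x \<and> ?C y}"
      by (simp only: case_prod_unfold mem_Collect_eq)
  qed
  then have "measure_pmf.prob (pair_pmf (random_bits b n) (random_bits b n)) {(x, y). ?C (resample \<rho> x y)}
    \<le> measure_pmf.prob (pair_pmf (random_bits b n) (random_bits b n)) {(x, y). ?C x \<and> ?C y}"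
    by (rule measure_pmf.finite_measure_mono) simp
  also have "\<dots> = (measure_pmf.prob (random_bits b n) {x. ?C x})\<^sup>2"
    unfolding prob_pair_pmf_Times by (simp add: power2_eq_square)
  also have "\<dots> \<le> Q\<^sup>2" using Q by (intro power_mono) auto
  finally show ?thesis .
qed

end

section \<open>The randomized bound\<close>

definition conflict :: "nat \<Rightarrow> port_graph \<Rightarrow> (nat \<Rightarrow> nat) \<Rightarrow> nat \<Rightarrow> bool" where
  "conflict k G c v \<longleftrightarrow> c v \<notin> {1..k} \<or> c v \<in> c ` set (G v)"

lemma proper_coloring_iff_conflict: "proper_coloring k n G c \<longleftrightarrow> \<not> (\<exists>v<n. conflict k G c v)"
  unfolding proper_coloring_def conflict_def image_iff by metis

lemma computable_conflict:
  assumes "computable_in n t \<Phi>"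
  shows "computable_in n (Suc t) (\<lambda>G x. conflict k G (\<Phi> G x))"
proof -
  have "computable_in n (Suc t) (\<lambda>G x v. (\<lambda>a as. a \<notin> {1..k} \<or> a \<in> set as) (\<Phi> G x v) (map (\<Phi> G x) (G v)))"
    by (rule computable_map2[OF computable_mono[OF assms] computable_neighbors'[OF assms]]) simp
  then show ?thesis by (rule computable_in_cong) (simp add: conflict_def)
qed

lemma local_failure_conflict:
  assumes "computable_in n t \<Phi>" "is_graph n G"
  shows "local_failure n G (Suc t) (\<lambda>x. conflict k G (\<Phi> G x))"
proof
  show "conflict k G (\<Phi> G x) v = conflict k G (\<Phi> G y) v"
    if "v < n" "\<And>u. reach G (Suc t) v u \<Longrightarrow> x u = y u" for x y v
    by (rule computable_locality[OF computable_conflict[OF assms(1)] assms(2)]) (use that in auto)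
qed (rule assms)

section \<open>Boosting the success probability\<close>

text \<open>The first \<open>b\<close> bits of each string serve the first run; the rest is held
  back for resampling.\<close>

definition boost ::
  "nat \<Rightarrow> nat \<Rightarrow> nat \<Rightarrow> (port_graph \<Rightarrow> (nat \<Rightarrow> bool list) \<Rightarrow> nat \<Rightarrow> nat) \<Rightarrow>
    port_graph \<Rightarrow> (nat \<Rightarrow> bool list) \<Rightarrow> nat \<Rightarrow> nat" where
  "boost k b \<rho> \<Phi> G z =
     \<Phi> G (resample_near G (\<lambda>x. conflict k G (\<Phi> G x)) \<rho> (\<lambda>v. take b (z v)) (\<lambda>v. drop b (z v)))"

text \<open>Detecting the conflicts of the first run takes \<open>t + 2\<close> rounds, spreading
  them \<open>72 + 3 * Suc t\<close>, and the second run \<open>t + 1\<close>.\<close>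

lemma computable_boost:
  assumes "computable_in n t \<Phi>"
  shows "computable_in n (5 * t + 78) (boost k b (72 + 3 * Suc t) \<Phi>)"
proof -
  let ?\<rho> = "72 + 3 * Suc t"
  have fst: "computable_in n 0 (\<lambda>G (z :: nat \<Rightarrow> bool list) v. take b (z v))"
    by (rule computable_map[OF computable_input])
  have pair: "computable_in n 0 (\<lambda>G (z :: nat \<Rightarrow> bool list) v. (take b (z v), drop b (z v)))"
    by (rule computable_map[OF computable_input])
  have "computable_in n (Suc 0 + Suc t)
      (\<lambda>G (z :: nat \<Rightarrow> bool list). conflict k G (\<Phi> G (\<lambda>v. take b (z v))))"
    by (rule computable_compose[OF fst computable_conflict[OF assms]])
  from computable_within[OF this, of ?\<rho>]
  have "computable_in n (Suc 0 + Suc t + ?\<rho>) (\<lambda>G z. resample_near G (\<lambda>x. conflict k G (\<Phi> G x)) ?\<rho>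
      (\<lambda>v. take b (z v)) (\<lambda>v. drop b (z v)))"
    unfolding resample_near_def
    by (rule computable_map2[OF _ computable_mono[OF pair], where h = "\<lambda>c (x, y). if c then y else x",
          simplified prod.case]) simp
  from computable_compose[OF this assms]
  have "computable_in n (Suc (Suc 0 + Suc t + ?\<rho>) + t) (boost k b ?\<rho> \<Phi>)"
    unfolding boost_def .
  then show ?thesis by (rule computable_mono) simp
qed

lemma prob_boost:
  "measure_pmf.prob (random_bits (b + b) n) {z. P (boost k b \<rho> \<Phi> G z)}
    = measure_pmf.prob (pair_pmf (random_bits b n) (random_bits b n))
        {(x, y). P (\<Phi> G (resample_near G (\<lambda>x. conflict k G (\<Phi> G x)) \<rho> x y))}"
  unfolding split_random_bits[symmetric] by (simp add: boost_def vimage_def)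

lemma prob_mono_support:
  assumes "\<And>x. x \<in> set_pmf p \<Longrightarrow> P x \<Longrightarrow> Q x"
  shows "measure_pmf.prob p {x. P x} \<le> measure_pmf.prob p {x. Q x}"
  by (rule measure_pmf.finite_measure_mono_AE) (use assms in \<open>auto simp: AE_measure_pmf_iff\<close>)

lemma prob_not:
  "measure_pmf.prob p {x. \<not> P x} = 1 - measure_pmf.prob p {x. P x}"
proof -
  have "{x. \<not> P x} = space (measure_pmf p) - {x. P x}" by auto
  then show ?thesis by (simp only:) (rule measure_pmf.prob_compl, simp)
qed

text \<open>The first \<open>b\<close> bits fix the leftover graph and the others are independent of
  it, so the success guarantees multiply. Outputs may be read at \<open>T\<close> and
  \<open>T'\<close> because \<open>rand_time\<close> covers all bit strings.\<close>

lemma two_phase_success: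
  assumes n: "1 \<le> n" and k: "3 \<le> k" "k \<le> D" and G: "G \<in> graphs n D" "clique_free (k + 1) n G"
    and A: "rand_correct (D + 1) n D (graphs n D) b A" "rand_time n D (graphs n D) b A \<le> enat T"
    and B: "rand_correct k n k {G \<in> graphs n k. colorable k n G} b' B"
      "rand_time n k {G \<in> graphs n k. colorable k n G} b' B \<le> enat T'"
  shows "measure_pmf.prob (random_bits (b + b') n)
      {z. proper_coloring D n G (two_phase n k D A T B T' G (\<lambda>v. take b (z v)) (\<lambda>v. drop b (z v)))}
    \<ge> (1 - 1 / n)\<^sup>2"
proof -
  define P where "P x \<longleftrightarrow> proper_coloring (D + 1) n G (output_at A n D G x T)" for x
  define H where "H x = uncolored_part G (D - k) (leftover n k D A T G x)" for x
  define Q where "Q x y \<longleftrightarrow> proper_coloring k n (H x) (output_at B n k (H x) y T')" for x y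
  have time: "running_time C n d F x \<le> enat S" if "rand_time n d \<F> m C \<le> enat S" "F \<in> \<F>" "x \<in> inputs m n"
    for C d \<F> m F x S
  proof -
    have "x \<in> {x. \<forall>v<n. x v \<in> bit_strings m}" using that(3) by (simp add: inputs_iff bit_strings_def)
    then have "running_time C n d F x \<le> rand_time n d \<F> m C"
      unfolding rand_time_def using that(2) by (intro SUP_upper2[of F] SUP_upper) auto
    then show ?thesis using that(1) by (rule order_trans)
  qed
  have "1 - 1 / n \<le> measure_pmf.prob (random_bits b n) {x. colors_properly (D + 1) A n D G x}"
    using A(1) G unfolding rand_correct_def by blast
  also have "\<dots> \<le> measure_pmf.prob (random_bits b n) {x. P x}"
    using time[OF A(2) G(1)] G unfolding P_def
    by (intro prob_mono_support colors_properly_output_at) (auto simp: graphs_def)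
  finally have 1: "1 - 1 / n \<le> measure_pmf.prob (random_bits b n) {x. P x}" .
  have 2: "1 - 1 / n \<le> measure_pmf.prob (random_bits b' n) {y. Q x y}" if "P x" for x
  proof -
    have H: "H x \<in> {G \<in> graphs n k. colorable k n G}"
      using uncolored_part(1,2)[OF n k G that[unfolded P_def]] unfolding H_def leftover_def by simp
    then have "1 - 1 / n \<le> measure_pmf.prob (random_bits b' n) {y. colors_properly k B n k (H x) y}"
      using B(1) unfolding rand_correct_def by blast
    also have "\<dots> \<le> measure_pmf.prob (random_bits b' n) {y. Q x y}"
      using time[OF B(2) H] H unfolding Q_def
      by (intro prob_mono_support colors_properly_output_at) (auto simp: graphs_def)
    finally show ?thesis .
  qed
  have n1: "0 \<le> 1 - 1 / real n" using n by simp
  have "(1 - 1 / n)\<^sup>2 \<le> (1 - 1 / n) * measure_pmf.prob (random_bits b n) {x. P x}"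
    unfolding power2_eq_square using 1 n1 by (rule mult_left_mono)
  also have "\<dots> \<le> measure_pmf.prob (pair_pmf (random_bits b n) (random_bits b' n)) {(x, y). P x \<and> Q x y}"
    by (rule prob_pair_pmf_ge[OF 2 n1])
  also have "\<dots> \<le> measure_pmf.prob (pair_pmf (random_bits b n) (random_bits b' n))
      {(x, y). proper_coloring D n G (two_phase n k D A T B T' G x y)}"
  proof (rule measure_pmf.finite_measure_mono)
    show "{(x, y). P x \<and> Q x y} \<subseteq> {(x, y). proper_coloring D n G (two_phase n k D A T B T' G x y)}"
      using uncolored_part(3)[OF n k G] unfolding P_def Q_def H_def leftover_def two_phase_def Let_def by auto
  qed simp
  also have "\<dots> = measure_pmf.prob (random_bits (b + b') n)
      {z. proper_coloring D n G (two_phase n k D A T B T' G (\<lambda>v. take b (z v)) (\<lambda>v. drop b (z v)))}"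
    unfolding split_random_bits[symmetric] by (simp add: vimage_def)
  finally show ?thesis .
qed

text \<open>
  On few nodes, resampling always reruns a whole component, which squares its failure probability. The
  factor 83 comes from \<open>5 * t + 78 \<le> 83 * t\<close>.
\<close>

lemma boost_small:
  assumes n: "n < 40" and \<G>: "\<And>G. G \<in> \<G> \<Longrightarrow> is_graph n G"
    and \<Phi>: "computable_in n t \<Phi>" "1 \<le> t"
    and Q: "\<And>G v. G \<in> \<G> \<Longrightarrow> v < n \<Longrightarrow>
      measure_pmf.prob (random_bits b n) {x. \<exists>u. reach G n v u \<and> conflict k G (\<Phi> G x) u} \<le> Q"
  shows "\<exists>b \<Phi>. computable_in n (83 ^ i * t) \<Phi> \<and> (\<forall>G\<in>\<G>. \<forall>v<n.
      measure_pmf.prob (random_bits b n) {x. \<exists>u. reach G n v u \<and> conflict k G (\<Phi> G x) u} \<le> Q ^ (2 ^ i))"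
proof (induction i)
  case 0
  then show ?case using \<Phi> Q by auto
next
  case (Suc i)
  then obtain b \<Phi> where IH: "computable_in n (83 ^ i * t) \<Phi>"
    "\<And>G v. G \<in> \<G> \<Longrightarrow> v < n \<Longrightarrow>
      measure_pmf.prob (random_bits b n) {x. \<exists>u. reach G n v u \<and> conflict k G (\<Phi> G x) u} \<le> Q ^ (2 ^ i)"
    by blast
  let ?\<rho> = "72 + 3 * Suc (83 ^ i * t)"
  have "1 \<le> 83 ^ i * t" using \<Phi>(2) by simp
  then have "5 * (83 ^ i * t) + 78 \<le> 83 ^ Suc i * t" by simp
  then have "computable_in n (83 ^ Suc i * t) (boost k b ?\<rho> \<Phi>)"
    by (rule computable_mono[OF computable_boost[OF IH(1)]])
  moreover have "measure_pmf.prob (random_bits (b + b) n)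
      {z. \<exists>u. reach G n v u \<and> conflict k G (boost k b ?\<rho> \<Phi> G z) u} \<le> Q ^ (2 ^ Suc i)"
    if "G \<in> \<G>" "v < n" for G v
  proof -
    interpret local_failure n G "Suc (83 ^ i * t)" "\<lambda>x. conflict k G (\<Phi> G x)"
      by (rule local_failure_conflict[OF IH(1) \<G>[OF that(1)]])
    \<comment> \<open>The constant 72 in the radius exceeds \<open>n\<close>, so whole components
      are resampled at every stage.\<close>
    have "n \<le> ?\<rho>" using n by simp
    from resample_failure_component[OF that(2) this IH(2)[OF that]]
    show ?thesis
      unfolding prob_boost[where P = "\<lambda>c. \<exists>u. reach G n v u \<and> conflict k G c u"]
      by (simp add: power_mult[symmetric] mult.commute)
  qed
  ultimately show ?case by blast
qed

text \<open>Below 40 nodes, five squarings take \<open>3 / 4\<close> to \<open>(3 / 4) ^ 32\<close>,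
  small enough for a union bound over the nodes. From 40 nodes on, a single resampling suffices.
  Both fit into \<open>83 ^ 5 * t\<close> rounds.\<close>

lemma boost_success:
  assumes n: "2 \<le> n" and \<G>: "\<And>G. G \<in> \<G> \<Longrightarrow> is_graph n G"
    and \<Phi>: "computable_in n t \<Phi>" "1 \<le> t"
    and q: "\<And>G. G \<in> \<G> \<Longrightarrow>
      (1 - 1 / n)\<^sup>2 \<le> measure_pmf.prob (random_bits b n) {x. proper_coloring k n G (\<Phi> G x)}"
  shows "\<exists>b \<Phi>. computable_in n (83 ^ 5 * t) \<Phi> \<and> (\<forall>G\<in>\<G>.
      1 - 1 / n \<le> measure_pmf.prob (random_bits b n) {x. proper_coloring k n G (\<Phi> G x)})"
proof -
  have fail: "measure_pmf.prob (random_bits b n) {x. \<exists>v<n. conflict k G (\<Phi> G x) v} \<le> 1 - (1 - 1 / n)\<^sup>2"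
    if "G \<in> \<G>" for G
    using q[OF that] unfolding proper_coloring_iff_conflict prob_not by linarith
  show ?thesis
  proof (cases "n < 40")
    case True
    have "1 / real n \<le> 1 / 2" using n by (intro divide_left_mono) auto
    then have "(1 / 2)\<^sup>2 \<le> (1 - 1 / real n)\<^sup>2" by (intro power_mono) auto
    then have Q: "1 - (1 - 1 / real n)\<^sup>2 \<le> 3 / 4" by (simp add: power2_eq_square)
    have component: "measure_pmf.prob (random_bits b n) {x. \<exists>u. reach G n v u \<and> conflict k G (\<Phi> G x) u} \<le> 3 / 4"
      if "G \<in> \<G>" "v < n" for G v
    proof -
      have "measure_pmf.prob (random_bits b n) {x. \<exists>u. reach G n v u \<and> conflict k G (\<Phi> G x) u}
        \<le> measure_pmf.prob (random_bits b n) {x. \<exists>v<n. conflict k G (\<Phi> G x) v}"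
        using reach_less[OF \<G>[OF that(1)] that(2)] by (intro prob_mono_support) blast
      then show ?thesis using fail[OF that(1)] Q by linarith
    qed
    have "\<exists>b \<Phi>. computable_in n (83 ^ 5 * t) \<Phi> \<and> (\<forall>G\<in>\<G>. \<forall>v<n. measure_pmf.prob (random_bits b n)
        {x. \<exists>u. reach G n v u \<and> conflict k G (\<Phi> G x) u} \<le> (3 / 4) ^ (2 ^ 5))"
      by (rule boost_small[OF True _ \<Phi>]) (fact \<G>, fact component)
    then obtain b \<Phi> where boosted: "computable_in n (83 ^ 5 * t) \<Phi>"
      "\<forall>G\<in>\<G>. \<forall>v<n. measure_pmf.prob (random_bits b n)
        {x. \<exists>u. reach G n v u \<and> conflict k G (\<Phi> G x) u} \<le> (3 / 4) ^ (2 ^ 5)"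
      by (elim exE conjE) (rule that)
    have "measure_pmf.prob (random_bits b n) {x. \<exists>v<n. conflict k G (\<Phi> G x) v} \<le> 1 / n"
      if G: "G \<in> \<G>" for G
    proof -
      have "measure_pmf.prob (random_bits b n) {x. \<exists>v<n. conflict k G (\<Phi> G x) v}
          \<le> measure_pmf.prob (random_bits b n) (\<Union>v<n. {x. \<exists>u. reach G n v u \<and> conflict k G (\<Phi> G x) u})"
        by (intro measure_pmf.finite_measure_mono) (auto intro: reach_refl)
      also have "\<dots> \<le> (\<Sum>v<n. measure_pmf.prob (random_bits b n) {x. \<exists>u. reach G n v u \<and> conflict k G (\<Phi> G x) u})"
        by (rule measure_pmf.finite_measure_subadditive_finite) auto
      also have "\<dots> \<le> (\<Sum>v<n. (3 / 4) ^ (2 ^ 5))" using boosted(2) G by (intro sum_mono) blast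
      also have "\<dots> = real n * (3 / 4) ^ 32" by simp
      also have "\<dots> \<le> 1 / n"
      proof -
        have "real n * real n \<le> 40 * 40" using True by (intro mult_mono) auto
        then have "real n * real n * (3 / 4) ^ 32 \<le> 40 * 40 * (3 / 4) ^ 32" by (rule mult_right_mono) simp
        also have "\<dots> \<le> 1" by (simp add: power_divide)
        finally show ?thesis using n by (simp add: field_simps)
      qed
      finally show ?thesis .
    qed
    then have "1 - 1 / n \<le> measure_pmf.prob (random_bits b n) {x. proper_coloring k n G (\<Phi> G x)}"
      if "G \<in> \<G>" for G using that unfolding proper_coloring_iff_conflict prob_not by force
    then show ?thesis using boosted(1) by blast
  next
    case False
    let ?\<rho> = "72 + 3 * Suc t"
    have "5 * t + 78 \<le> 83 ^ 5 * t" using \<Phi>(2) by simp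
    then have "computable_in n (83 ^ 5 * t) (boost k b ?\<rho> \<Phi>)"
      by (rule computable_mono[OF computable_boost[OF \<Phi>(1)]])
    moreover have "1 - 1 / n \<le> measure_pmf.prob (random_bits (b + b) n)
        {z. proper_coloring k n G (boost k b ?\<rho> \<Phi> G z)}" if G: "G \<in> \<G>" for G
    proof -
      interpret local_failure n G "Suc t" "\<lambda>x. conflict k G (\<Phi> G x)"
        by (rule local_failure_conflict[OF \<Phi>(1) \<G>[OF G]])
      have "1 - (1 - 1 / real n)\<^sup>2 \<le> 2 / n"
        by (simp add: power2_eq_square algebra_simps)
      then have "failure_prob b \<le> 2 / n" using fail[OF G] unfolding failure_prob_def by linarith
      with False have "measure_pmf.prob (random_bits (b + b) n)
          {z. \<exists>v<n. conflict k G (boost k b ?\<rho> \<Phi> G z) v} \<le> 1 / n"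
        unfolding prob_boost[where P = "\<lambda>c. \<exists>v<n. conflict k G c v"]
        by (intro resample_failure_large) auto
      then show ?thesis unfolding proper_coloring_iff_conflict prob_not by linarith
    qed
    ultimately show ?thesis by blast
  qed
qed

lemma randomized_bound:
  assumes n: "1 \<le> n" and k: "3 \<le> k" "k \<le> D"
  shows "T_rand_Delta_col_clique_free k n D
    \<le> enat (2 * 83 ^ 5) * (T_rand_Delta_plus_one_col n D + enat k + T_rand_Delta_col n k)"
proof (cases "T_rand_Delta_plus_one_col n D = \<infinity> \<or> T_rand_Delta_col n k = \<infinity>")
  case True
  then show ?thesis by (auto simp: imult_is_infinity zero_enat_def)
next
  case False
  then obtain T T' where T: "T_rand_Delta_plus_one_col n D = enat T" "T_rand_Delta_col n k = enat T'" by auto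
  obtain b A where A: "rand_correct (D + 1) n D (graphs n D) b A" "rand_time n D (graphs n D) b A \<le> enat T"
    by (rule INF_enat_attained[OF T(1)[THEN eq_refl, unfolded T_rand_Delta_plus_one_col_def rand_complexity_def]])
      auto
  obtain b' B where B: "rand_correct k n k {G \<in> graphs n k. colorable k n G} b' B"
      "rand_time n k {G \<in> graphs n k. colorable k n G} b' B \<le> enat T'"
    by (rule INF_enat_attained[OF T(2)[THEN eq_refl, unfolded T_rand_Delta_col_def rand_complexity_def]])
      auto
  define \<G> where "\<G> = {G \<in> graphs n D. clique_free (k + 1) n G}"
  define t where "t = T + k + T' + 3"
  define \<Phi>\<^sub>0 where "\<Phi>\<^sub>0 G z = two_phase n k D A T B T' G (\<lambda>v. take b (z v)) (\<lambda>v. drop b (z v))" for G z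
  have \<Phi>\<^sub>0: "computable_in n t \<Phi>\<^sub>0" unfolding t_def \<Phi>\<^sub>0_def by (rule computable_two_phase)
  have graph: "is_graph n G" if "G \<in> \<G>" for G using that by (auto simp: \<G>_def graphs_def)
  have "\<exists>b \<Phi>. computable_in n (83 ^ 5 * t) \<Phi> \<and> (\<forall>G\<in>\<G>.
      1 - 1 / n \<le> measure_pmf.prob (random_bits b n) {x. proper_coloring D n G (\<Phi> G x)})"
  \<comment> \<open>For \<open>n = 1\<close> the required success probability
    \<open>1 - 1 / n\<close> is 0; boosting has to start from a positive one.\<close>
  proof (cases "n = 1")
    case True
    then show ?thesis
      by (intro exI[of _ b] exI[of _ \<Phi>\<^sub>0] conjI computable_mono[OF \<Phi>\<^sub>0]) auto
  next
    case False
    show ?thesis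
      by (rule boost_success[OF _ graph \<Phi>\<^sub>0, of \<G> "b + b'"])
        (use False n two_phase_success[OF n k _ _ A B] in \<open>auto simp: \<G>_def \<Phi>\<^sub>0_def t_def\<close>)
  qed
  then obtain c \<Phi> where \<Phi>: "computable_in n (83 ^ 5 * t) \<Phi>"
    "\<And>G. G \<in> \<G> \<Longrightarrow> 1 - 1 / n \<le> measure_pmf.prob (random_bits c n) {x. proper_coloring D n G (\<Phi> G x)}"
    by blast
  obtain M where M: "\<And>D G x. is_graph n G \<Longrightarrow> running_time M n D G x \<le> enat (83 ^ 5 * t)"
    "\<And>k D G x. is_graph n G \<Longrightarrow> proper_coloring k n G (\<Phi> G x) \<Longrightarrow> colors_properly k M n D G x"
    using implement_computable[OF \<Phi>(1)] by blast
  have "rand_correct D n D \<G> c M"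
    unfolding rand_correct_def
  proof
    fix G assume G: "G \<in> \<G>"
    have "measure_pmf.prob (random_bits c n) {x. proper_coloring D n G (\<Phi> G x)}
        \<le> measure_pmf.prob (random_bits c n) {x. colors_properly D M n D G x}"
      using M(2)[OF graph[OF G]] by (intro prob_mono_support)
    then show "1 - 1 / real n \<le> measure_pmf.prob (random_bits c n) {x. colors_properly D M n D G x}"
      using \<Phi>(2)[OF G] by linarith
  qed
  then have "rand_complexity D n D \<G> \<le> rand_time n D \<G> c M"
    unfolding rand_complexity_def by (intro INF_lower2[of "(c, M)"]) auto
  also have "\<dots> \<le> enat (83 ^ 5 * t)"
    unfolding rand_time_def by (intro SUP_least M(1) graph)
  \<comment> \<open>From \<open>3 \<le> k\<close> follows
    \<open>t \<le> 2 * (T + k + T')\<close>.\<close>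
  also have "\<dots> \<le> enat (2 * 83 ^ 5) * (enat T + enat k + enat T')"
    using k by (simp add: t_def)
  finally show ?thesis unfolding T_rand_Delta_col_clique_free_def \<G>_def T .
qed

theorem theorem1p5:
  fixes idb :: "nat \<Rightarrow> nat"
  assumes "\<And>n. n \<le> idb n"
    and "\<exists>c. (\<lambda>n. real (idb n)) \<in> O(\<lambda>n. real n ^ c)"
  shows "(\<exists>C::nat. \<forall>\<omega> \<Delta> n. 3 \<le> \<omega> \<longrightarrow> \<omega> \<le> \<Delta> \<longrightarrow> 1 \<le> n \<longrightarrow>
            T_Delta_col_clique_free idb \<omega> n \<Delta>
              \<le> enat C * (T_Delta_plus_one_col idb n \<Delta> + enat \<omega> + T_Delta_col idb n \<omega>))
       \<and> (\<exists>C::nat. \<forall>\<omega> \<Delta> n. 3 \<le> \<omega> \<longrightarrow> \<omega> \<le> \<Delta> \<longrightarrow> 1 \<le> n \<longrightarrow>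
            T_rand_Delta_col_clique_free \<omega> n \<Delta>
              \<le> enat C * (T_rand_Delta_plus_one_col n \<Delta> + enat \<omega> + T_rand_Delta_col n \<omega>))"
proof
  show "\<exists>C::nat. \<forall>\<omega> \<Delta> n. 3 \<le> \<omega> \<longrightarrow> \<omega> \<le> \<Delta> \<longrightarrow> 1 \<le> n \<longrightarrow>
      T_Delta_col_clique_free idb \<omega> n \<Delta>
        \<le> enat C * (T_Delta_plus_one_col idb n \<Delta> + enat \<omega> + T_Delta_col idb n \<omega>)"
    using deterministic_bound[where idb = idb] by (intro exI[of _ 2]) (simp add: numeral_eq_enat)
  show "\<exists>C::nat. \<forall>\<omega> \<Delta> n. 3 \<le> \<omega> \<longrightarrow> \<omega> \<le> \<Delta> \<longrightarrow> 1 \<le> n \<longrightarrow>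
      T_rand_Delta_col_clique_free \<omega> n \<Delta>
        \<le> enat C * (T_rand_Delta_plus_one_col n \<Delta> + enat \<omega> + T_rand_Delta_col n \<omega>)"
    using randomized_bound by blast
qed

end
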